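(* Let $\mu=N_d(A)$ and $\nu=N_d(B)$ be two centered Gaussian measures on $\mathbb{R}^d$ with non-singular covariance matrices $A$ and $B$. Let $\Sigma\in S_{2d}^{++}(\mathbb{R})$ be a full-rank covariance matrix on $\mathbb{R}^d\times\mathbb{R}^d$, with inverse $\Gamma:=\Sigma^{-1}$ having upper-right $d\times d$ block $\Gamma_{12}$, and put $M_\varepsilon:=I_d-\varepsilon\Gamma_{12}$. Then for all $\varepsilon>0$ such that $M_\varepsilon$ is invertible, the regularized optimal transport problem $$\inf_{\pi\in\Pi(\mu,\nu)}\int_{\mathbb{R}^d\times\mathbb{R}^d}\|x-y\|^2\,d\pi(x,y)+2\varepsilon\,\mathrm{KL}(\pi\,|\,N_{2d}(\Sigma))$$ has a unique solution, given by the Gaussian measure $$\pi_\varepsilon^\star:=N_{2d}\begin{pmatrix}A & C_\varepsilon\\ C_\varepsilon^T & B\end{pmatrix},\qquad C_\varepsilon=\left[\left(AM_\varepsilon BM_\varepsilon^T+\frac{\varepsilon^2}{4}I_d\right)^{1/2}-\frac{\varepsilon}{2}I_d\right](M_\varepsilon^T)^{-1}.$$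
   Context: $S_{k}^{++}(\mathbb{R})$ is the set of real symmetric positive-definite $k\times k$ matrices. $N_d(A)$ denotes the centered Gaussian measure on $\mathbb{R}^d$ with covariance $A$, and $N_{2d}(\Sigma)$ the centered Gaussian measure on $\mathbb{R}^d\times\mathbb{R}^d$ with covariance $\Sigma$. $\Pi(\mu,\nu)$ is the set of probability measures on $\mathbb{R}^d\times\mathbb{R}^d$ with first marginal $\mu$ and second marginal $\nu$. $\mathrm{KL}(\pi|\pi_{\mathrm{ref}}):=\int\log\left(\frac{d\pi}{d\pi_{\mathrm{ref}}}\right)d\pi$ if $\pi$ is absolutely continuous with respect to $\pi_{\mathrm{ref}}$, and $+\infty$ otherwise. The block decomposition is $\Gamma=\begin{pmatrix}\Gamma_{11}&\Gamma_{12}\\ \Gamma_{12}^T&\Gamma_{22}\end{pmatrix}$ with $d\times d$ blocks. Since $AM_\varepsilon BM_\varepsilon^T$ need not be symmetric, the square root is defined by $$\left(AM_\varepsilon BM_\varepsilon^T+\tfrac{\varepsilon^2}{4}I_d\right)^{1/2}:=A^{1/2}\left(A^{1/2}M_\varepsilon BM_\varepsilon^TA^{1/2}+\tfrac{\varepsilon^2}{4}I_d\right)^{1/2}A^{-1/2},$$ where the square roots on the right are the usual positive-definite square roots of symmetric positive-definite matrices. *)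

theory Defs
  imports "HOL-Probability.Probability"
begin

section \<open>Symmetric positive-definite matrices\<close>

definition pos_def :: "real ^ 'k ^ 'k \<Rightarrow> bool" where
  "pos_def A \<longleftrightarrow> transpose A = A \<and> (\<forall>x. x \<noteq> 0 \<longrightarrow> 0 < x \<bullet> (A *v x))"

text \<open>Meaningful for positive-definite arguments only, where the root exists and is unique.\<close>

definition pd_sqrt :: "real ^ 'k ^ 'k \<Rightarrow> real ^ 'k ^ 'k" where
  "pd_sqrt A = (THE R. pos_def R \<and> R ** R = A)"

text \<open>
  The square root of the matrix \<open>A P + c I\<close>, for \<open>A\<close> positive definite and \<open>P\<close> symmetric; that
  matrix is not symmetric in general, but it is similar, through the root of \<open>A\<close>, to the
  symmetric matrix whose root is taken here.
\<close>

definition twisted_sqrt :: "real ^ 'k ^ 'k \<Rightarrow> real ^ 'k ^ 'k \<Rightarrow> real \<Rightarrow> real ^ 'k ^ 'k" where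
  "twisted_sqrt A P c =
     pd_sqrt A ** pd_sqrt (pd_sqrt A ** P ** pd_sqrt A + c *\<^sub>R mat 1) ** matrix_inv (pd_sqrt A)"

section \<open>Block matrices\<close>

text \<open>The index type \<open>'n + 'n\<close> carries the block structure: \<open>Inl\<close> is the first block of
  coordinates, \<open>Inr\<close> the second.\<close>

definition block_matrix ::
  "real ^ 'n ^ 'n \<Rightarrow> real ^ 'n ^ 'n \<Rightarrow> real ^ 'n ^ 'n \<Rightarrow> real ^ 'n ^ 'n \<Rightarrow>
   real ^ ('n + 'n) ^ ('n + 'n)" where
  "block_matrix P Q R S = (\<chi> i j.
     case i of
       Inl a \<Rightarrow> (case j of Inl b \<Rightarrow> P $ a $ b | Inr b \<Rightarrow> Q $ a $ b)
     | Inr a \<Rightarrow> (case j of Inl b \<Rightarrow> R $ a $ b | Inr b \<Rightarrow> S $ a $ b))"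

definition block12 :: "real ^ ('n + 'n) ^ ('n + 'n) \<Rightarrow> real ^ 'n ^ 'n" where
  "block12 G = (\<chi> i j. G $ Inl i $ Inr j)"

definition split_vec :: "real ^ ('n + 'n) \<Rightarrow> (real ^ 'n) \<times> (real ^ 'n)" where
  "split_vec z = (\<chi> i. z $ Inl i, \<chi> i. z $ Inr i)"

section \<open>Centered Gaussian measures with non-singular covariance\<close>

definition gaussian_density :: "real ^ 'k ^ 'k \<Rightarrow> real ^ 'k \<Rightarrow> real" where
  "gaussian_density A x =
     exp (- (x \<bullet> (matrix_inv A *v x)) / 2) / sqrt ((2 * pi) ^ CARD('k) * det A)"

definition gaussian :: "real ^ 'k ^ 'k \<Rightarrow> (real ^ 'k) measure" where
  "gaussian A = density lborel (\<lambda>x. ennreal (gaussian_density A x))"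

definition gaussian_pair ::
  "real ^ ('n + 'n) ^ ('n + 'n) \<Rightarrow> ((real ^ 'n) \<times> (real ^ 'n)) measure" where
  "gaussian_pair S = distr (gaussian S) borel split_vec"

section \<open>Entropic optimal transport\<close>

definition couplings ::
  "(real ^ 'n) measure \<Rightarrow> (real ^ 'n) measure \<Rightarrow> ((real ^ 'n) \<times> (real ^ 'n)) measure set" where
  "couplings \<mu> \<nu> = {\<pi>. sets \<pi> = sets borel \<and> prob_space \<pi> \<and>
     distr \<pi> borel fst = \<mu> \<and> distr \<pi> borel snd = \<nu>}"

text \<open>
  \<open>KL \<pi> \<rho>\<close> is \<open>KL(\<pi>|\<rho>)\<close>; the library's \<open>KL_divergence b \<rho> \<pi>\<close> has the arguments in the opposite
  order and logarithm base \<open>b\<close>. As a Bochner integral it is \<open>0\<close>, not infinite, when the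
  log-density is not integrable. For probability measures with \<open>\<pi>\<close> absolutely continuous with
  respect to \<open>\<rho>\<close>, the negative part of the log-density is always \<open>\<pi>\<close>-integrable (since
  \<open>t ln t \<ge> - 1 / e\<close>), so a non-integrable log-density means that the integral is \<open>+\<infinity>\<close>.
\<close>

definition KL :: "'a measure \<Rightarrow> 'a measure \<Rightarrow> ereal" where
  "KL \<pi> \<rho> =
     (if absolutely_continuous \<rho> \<pi> \<and> integrable \<pi> (entropy_density (exp 1) \<rho> \<pi>)
      then ereal (KL_divergence (exp 1) \<rho> \<pi>) else \<infinity>)"

definition eot_cost ::
  "real \<Rightarrow> ((real ^ 'n) \<times> (real ^ 'n)) measure \<Rightarrow> ((real ^ 'n) \<times> (real ^ 'n)) measure \<Rightarrow> ereal"
  where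
  "eot_cost \<epsilon> \<rho> \<pi> =
     enn2ereal (\<integral>\<^sup>+ (x, y). ennreal ((norm (x - y))\<^sup>2) \<partial>\<pi>) + ereal (2 * \<epsilon>) * KL \<pi> \<rho>"

definition eot_solutions ::
  "real \<Rightarrow> ((real ^ 'n) \<times> (real ^ 'n)) measure \<Rightarrow> (real ^ 'n) measure \<Rightarrow> (real ^ 'n) measure \<Rightarrow>
   ((real ^ 'n) \<times> (real ^ 'n)) measure set" where
  "eot_solutions \<epsilon> \<rho> \<mu> \<nu> =
     {\<pi> \<in> couplings \<mu> \<nu>. eot_cost \<epsilon> \<rho> \<pi> = (INF \<pi>'\<in>couplings \<mu> \<nu>. eot_cost \<epsilon> \<rho> \<pi>')}"

end

theory Submission
  imports Defs
begin

text \<open>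
  The objective is strictly minimized by any coupling whose density relative to the reference measure
  balances the transport cost. Suppose \<open>\<tau> = exp(h) \<rho>\<close> is a coupling of \<open>\<mu>\<close> and \<open>\<nu>\<close> with
  \<open>\<parallel>x - y\<parallel>\<^sup>2 + 2 \<epsilon> h(x, y) = a(x) + b(y)\<close>. The integral of the right-hand side is the same number \<open>K\<close> for
  all couplings, and the chain rule \<open>KL(\<pi>|\<rho>) = KL(\<pi>|\<tau>) + \<integral> h d\<pi>\<close> shows that the objective at a coupling
  \<open>\<pi>\<close> is \<open>K + 2 \<epsilon> KL(\<pi>|\<tau>)\<close>. Since \<open>KL(\<pi>|\<tau>)\<close> is nonnegative and vanishes only for \<open>\<pi> = \<tau>\<close>, the unique
  solution is \<open>\<tau>\<close> (\<open>eot_solutions_of_separated_potentials\<close>).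

  For Gaussian measures \<open>h\<close> is a quadratic polynomial, and its only term that involves both variables is
  governed by the difference of the off-diagonal blocks of the inverse covariances. The balance
  condition therefore says that the inverse of the covariance of \<open>\<tau>\<close> has the off-diagonal
  block \<open>\<Gamma>\<^sub>1\<^sub>2 - I / \<epsilon> = - M / \<epsilon>\<close>. By block elimination this is the equation
  \<open>M (B - C\<^sup>T A\<^sup>-\<^sup>1 C) = \<epsilon> A\<^sup>-\<^sup>1 C\<close> for the cross-covariance \<open>C\<close>, a quadratic matrix equation that is solved by
  completing the square; the given formula is the root that makes the Schur complement
  \<open>B - C\<^sup>T A\<^sup>-\<^sup>1 C\<close>, and with it the whole block matrix, positive definite (\<open>coupling_schur_equation\<close>,
  \<open>block12_matrix_inv\<close>, \<open>pos_def_block_iff\<close>).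

  The candidate is a coupling of the two given measures because a Gaussian measure is the image of the standard
  one under any factor of its covariance, and triangular factors exhibit the marginals
  (\<open>gaussian_linear_image\<close>, \<open>gaussian_pair_marginals\<close>). This rests on the behaviour of Lebesgue
  measure under linear maps (\<open>lborel_linear_image\<close>); the matrix square roots rest on the spectral
  theorem for real symmetric matrices (\<open>symmetric_orthonormal_eigenbasis\<close>).
\<close>

section \<open>Matrix algebra\<close>

text \<open>
  These equations push a matrix expression applied to a vector down to iterated applications of
  its factors. Identities between products of non-commuting matrices are proved below in this form,
  where a factor next to its inverse cancels by rewriting.
\<close>

lemmas matrix_vector_simps =
  matrix_vector_mul_assoc[symmetric] matrix_vector_mult_add_rdistrib
  matrix_vector_mult_diff_rdistrib matrix_vector_right_distrib
  matrix_vector_mult_diff_distrib matrix_vector_mult_scaleR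
  scaleR_matrix_vector_assoc[symmetric]

lemma inner_matrix_vector_left: "((A :: real ^ 'm ^ 'k) *v x) \<bullet> y = x \<bullet> (transpose A *v y)"
  by (metis dot_lmul_matrix vector_transpose_matrix transpose_transpose)

lemma transpose_add: "transpose (A + B) = transpose A + transpose B"
  by (simp add: transpose_def vec_eq_iff)

lemma transpose_diff: "transpose (A - B :: real ^ 'm ^ 'k) = transpose A - transpose B"
  by (simp add: transpose_def vec_eq_iff)

lemma symmetric_matrixI:
  fixes A :: "real ^ 'k ^ 'k"
  assumes "\<And>x y. (A *v x) \<bullet> y = x \<bullet> (A *v y)"
  shows "transpose A = A"
proof -
  have "transpose A *v y = A *v y" for y
    using assms by (intro vector_eq_ldot[THEN iffD1]) (simp add: inner_matrix_vector_left)
  then show ?thesis by (simp add: matrix_eq)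
qed

lemma matrix_inv_mult:
  assumes "invertible (A :: real ^ 'k ^ 'k)"
  shows "A ** matrix_inv A = mat 1" and "matrix_inv A ** A = mat 1"
  using someI_ex[OF assms[unfolded invertible_def]] by (auto simp: matrix_inv_def)

lemma matrix_inv_cancel:
  assumes "invertible (A :: real ^ 'k ^ 'k)"
  shows "A *v (matrix_inv A *v x) = x" and "matrix_inv A *v (A *v x) = x"
  using matrix_inv_mult[OF assms] by (simp_all add: matrix_vector_mul_assoc)

lemma invertible_matrix_inv: "invertible (A :: real ^ 'k ^ 'k) \<Longrightarrow> invertible (matrix_inv A)"
  using matrix_inv_mult unfolding invertible_def by blast

section \<open>The spectral theorem\<close>

text \<open>
  The first-order condition at \<open>t = 0\<close> for a quadratic polynomial that is minimal there; a small step
  against the sign of \<open>a\<close> would make it negative.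
\<close>

lemma linear_coefficient_eq_0:
  fixes a b :: real
  assumes "\<And>t. 0 \<le> 2 * t * a + t\<^sup>2 * b"
  shows "a = 0"
proof (rule ccontr)
  assume "a \<noteq> 0"
  define p where "p = \<bar>b\<bar> + 1"
  \<comment> \<open>The minimizer of \<open>2 * t * a + t\<^sup>2 * p\<close>, a polynomial that dominates the given one.\<close>
  define t where "t = - a / p"
  have p: "p > 0" "b \<le> p" by (auto simp: p_def)
  have "t\<^sup>2 * b \<le> t\<^sup>2 * p" using p(2) by (intro mult_left_mono) auto
  also have "\<dots> = a\<^sup>2 / p"
    using p(1) by (simp add: t_def power2_eq_square field_simps)
  finally have "2 * t * a + t\<^sup>2 * b \<le> - (a\<^sup>2) / p"
    by (simp add: t_def power2_eq_square)
  also have "\<dots> < 0" using p(1) \<open>a \<noteq> 0\<close> by (simp add: divide_neg_pos)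
  finally show False using assms[of t] by simp
qed

text \<open>
  The eigenvector is a maximizer of \<open>x \<bullet> (A *v x)\<close> over the unit sphere of \<open>S\<close>, and the maximum \<open>l\<close> is its
  eigenvalue: the form \<open>l * (w \<bullet> w) - w \<bullet> (A *v w)\<close> is nonnegative on \<open>S\<close> and vanishes at \<open>v\<close>, so its
  derivative at \<open>v\<close> vanishes in every direction of \<open>S\<close>, in particular in the direction
  \<open>l *\<^sub>R v - A *v v\<close>.
\<close>

lemma symmetric_eigenvector_in_subspace:
  fixes A :: "real ^ 'k ^ 'k"
  assumes sym: "transpose A = A" and S: "subspace S" and inv: "\<And>x. x \<in> S \<Longrightarrow> A *v x \<in> S"
    and "S \<noteq> {0}"
  shows "\<exists>v\<in>S. norm v = 1 \<and> A *v v = (v \<bullet> (A *v v)) *\<^sub>R v"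
proof -
  let ?K = "sphere 0 1 \<inter> S"
  have comp: "compact ?K"
    by (intro compact_Int_closed compact_sphere closed_subspace S)
  obtain x where x: "x \<in> S" "x \<noteq> 0" using \<open>S \<noteq> {0}\<close> subspace_0[OF S] by blast
  have "(1 / norm x) *\<^sub>R x \<in> ?K" using x S by (auto intro: subspace_scale)
  then have ne: "?K \<noteq> {}" by blast
  have "continuous_on ?K (\<lambda>x. x \<bullet> (A *v x))"
    by (intro continuous_intros)
  then obtain v where v: "v \<in> ?K" and max: "\<And>w. w \<in> ?K \<Longrightarrow> w \<bullet> (A *v w) \<le> v \<bullet> (A *v v)"
    using continuous_attains_sup[OF comp ne] by blast
  define l where "l = v \<bullet> (A *v v)"
  have vS: "v \<in> S" and nv: "norm v = 1" using v by auto
  have gap: "0 \<le> l * (w \<bullet> w) - w \<bullet> (A *v w)" if "w \<in> S" for w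
  proof (cases "w = 0")
    case False
    let ?u = "(1 / norm w) *\<^sub>R w"
    have "?u \<in> ?K" using False that S by (auto intro: subspace_scale)
    from max[OF this] have "(w \<bullet> (A *v w)) / (norm w)\<^sup>2 \<le> l"
      by (simp add: l_def matrix_vector_simps power2_eq_square)
    then show ?thesis
      using False by (simp add: divide_le_eq power2_norm_eq_inner)
  qed simp
  have "l * (v \<bullet> w) - w \<bullet> (A *v v) = 0" if w: "w \<in> S" for w
  proof (rule linear_coefficient_eq_0)
    fix t :: real
    have "v + t *\<^sub>R w \<in> S" using vS w S by (auto intro: subspace_add subspace_scale)
    from gap[OF this]
    have "0 \<le> l * ((v + t *\<^sub>R w) \<bullet> (v + t *\<^sub>R w)) - (v + t *\<^sub>R w) \<bullet> (A *v (v + t *\<^sub>R w))" .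
    also have "\<dots> = 2 * t * (l * (v \<bullet> w) - w \<bullet> (A *v v)) + t\<^sup>2 * (l * (w \<bullet> w) - w \<bullet> (A *v w))"
    proof -
      have "v \<bullet> (A *v w) = w \<bullet> (A *v v)"
        using sym by (metis inner_matrix_vector_left inner_commute)
      moreover have "l * (v \<bullet> v) = v \<bullet> (A *v v)"
        using nv by (simp add: l_def norm_eq_1)
      ultimately show ?thesis
        by (simp add: matrix_vector_simps inner_add_left inner_add_right
            power2_eq_square algebra_simps inner_commute)
    qed
    finally show "0 \<le> 2 * t * (l * (v \<bullet> w) - w \<bullet> (A *v v)) + t\<^sup>2 * (l * (w \<bullet> w) - w \<bullet> (A *v w))" .
  qed
  note orth = this
  have "l *\<^sub>R v - A *v v \<in> S" using vS inv S by (auto intro: subspace_diff subspace_scale)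
  from orth[OF this] have "(l *\<^sub>R v - A *v v) \<bullet> (l *\<^sub>R v - A *v v) = 0"
    by (simp add: inner_diff_left inner_diff_right inner_commute algebra_simps)
  then have "A *v v = l *\<^sub>R v" by simp
  then show ?thesis using vS nv l_def by blast
qed

text \<open>
  Induction on the dimension of an invariant subspace: the part of \<open>S\<close> orthogonal to an eigenvector is
  again invariant, because the matrix is symmetric.
\<close>

lemma symmetric_orthonormal_eigenbasis_of_subspace:
  fixes A :: "real ^ 'k ^ 'k"
  assumes sym: "transpose A = A"
  shows "subspace S \<Longrightarrow> (\<And>x. x \<in> S \<Longrightarrow> A *v x \<in> S) \<Longrightarrow>
    \<exists>B. finite B \<and> pairwise orthogonal B \<and> (\<forall>b\<in>B. norm b = 1) \<and> span B = S \<and>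
        (\<forall>b\<in>B. A *v b = (b \<bullet> (A *v b)) *\<^sub>R b)"
proof (induction "dim S" arbitrary: S rule: less_induct)
  case less
  show ?case
  proof (cases "S = {0}")
    case True
    then show ?thesis by (intro exI[of _ "{}"]) auto
  next
    case False
    from symmetric_eigenvector_in_subspace[OF sym less.prems False] obtain v
      where v: "v \<in> S" "norm v = 1" "A *v v = (v \<bullet> (A *v v)) *\<^sub>R v" by blast
    define S' where "S' = {x \<in> S. v \<bullet> x = 0}"
    have S': "subspace S'"
      using less.prems(1) by (auto simp: S'_def subspace_def inner_add_right)
    have inv': "A *v x \<in> S'" if "x \<in> S'" for x
    proof -
      have "v \<bullet> (A *v x) = (A *v v) \<bullet> x"
        using sym by (simp add: inner_matrix_vector_left)
      also have "\<dots> = (v \<bullet> (A *v v)) * (v \<bullet> x)"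
        by (subst v(3)) simp
      finally show ?thesis using that less.prems(2) by (simp add: S'_def)
    qed
    have "v \<notin> S'" using v by (simp add: S'_def norm_eq_1)
    moreover have "S' \<subseteq> S" by (auto simp: S'_def)
    ultimately have "S' \<subset> S" using v(1) by blast
    then have "dim S' < dim S"
      using S' less.prems(1) by (intro dim_psubset) (simp add: span_eq_iff[THEN iffD2])
    from less.hyps[OF this S' inv'] obtain B where B: "finite B" "pairwise orthogonal B"
      "\<forall>b\<in>B. norm b = 1" "span B = S'" "\<forall>b\<in>B. A *v b = (b \<bullet> (A *v b)) *\<^sub>R b" by blast
    have BS': "B \<subseteq> S'" using B(4) span_superset by blast
    have span: "span (insert v B) = S"
    proof
      show "span (insert v B) \<subseteq> S"
        using v(1) BS' less.prems(1) by (intro span_minimal) (auto simp: S'_def)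
      show "S \<subseteq> span (insert v B)"
      proof
        fix x assume x: "x \<in> S"
        have "x - (v \<bullet> x) *\<^sub>R v \<in> S'"
          using x v less.prems(1)
          by (auto simp: S'_def inner_diff_right norm_eq_1 intro: subspace_diff subspace_scale)
        then show "x \<in> span (insert v B)"
          unfolding B(4)[symmetric] span_breakdown_eq by blast
      qed
    qed
    have "pairwise orthogonal (insert v B)"
      using B(2) BS' by (auto simp: pairwise_insert orthogonal_def S'_def inner_commute)
    then show ?thesis using B v span by (intro exI[of _ "insert v B"]) auto
  qed
qed

theorem symmetric_orthonormal_eigenbasis:
  fixes A :: "real ^ 'k ^ 'k"
  assumes "transpose A = A"
  obtains B where "finite B" "pairwise orthogonal B" "\<And>b. b \<in> B \<Longrightarrow> norm b = 1"
    "span B = UNIV" "\<And>b. b \<in> B \<Longrightarrow> A *v b = (b \<bullet> (A *v b)) *\<^sub>R b"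
  using symmetric_orthonormal_eigenbasis_of_subspace[OF assms, of UNIV] by force

section \<open>Positive-definite matrices and their square roots\<close>

lemma pos_def_sym: "pos_def A \<Longrightarrow> transpose A = A"
  by (simp add: pos_def_def)

lemma pos_def_inner: "pos_def A \<Longrightarrow> (A *v x) \<bullet> y = x \<bullet> (A *v y)"
  by (simp add: inner_matrix_vector_left pos_def_sym)

lemma pos_def_invertible:
  assumes "pos_def A"
  shows "invertible A"
proof -
  have "\<forall>x. A *v x = 0 \<longrightarrow> x = 0"
    using assms by (metis inner_zero_right less_irrefl pos_def_def)
  then show ?thesis
    using matrix_left_invertible_ker matrix_left_right_inverse unfolding invertible_def by blast
qed

lemma pos_def_matrix_inv:
  assumes "pos_def A"
  shows "pos_def (matrix_inv A)"
proof -
  note inv = matrix_inv_cancel[OF pos_def_invertible[OF assms]]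
  have "(matrix_inv A *v x) \<bullet> y = x \<bullet> (matrix_inv A *v y)" for x y
    by (metis inv(1) pos_def_inner[OF assms])
  moreover have "0 < x \<bullet> (matrix_inv A *v x)" if "x \<noteq> 0" for x
  proof -
    let ?y = "matrix_inv A *v x"
    have "?y \<noteq> 0" using that by (metis inv(1) matrix_vector_mult_0_right)
    then have "0 < ?y \<bullet> (A *v ?y)" using assms by (simp add: pos_def_def)
    then show ?thesis by (simp add: inv inner_commute)
  qed
  ultimately show ?thesis by (simp add: pos_def_def symmetric_matrixI)
qed

lemma pos_def_congruence:
  fixes A X :: "real ^ 'k ^ 'k"
  assumes "pos_def A" "invertible X"
  shows "pos_def (X ** A ** transpose X)"
proof -
  have "0 < x \<bullet> ((X ** A ** transpose X) *v x)" if "x \<noteq> 0" for x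
  proof -
    let ?y = "transpose X *v x"
    have "?y \<noteq> 0"
      using that matrix_inv_cancel(2)[OF transpose_invertible[OF assms(2)]]
      by (metis matrix_vector_mult_0_right)
    then have "0 < ?y \<bullet> (A *v ?y)" using assms(1) unfolding pos_def_def by blast
    also have "\<dots> = x \<bullet> (X *v (A *v ?y))"
      using inner_matrix_vector_left[of "transpose X" x] by simp
    finally show ?thesis by (simp only: matrix_vector_mul_assoc matrix_mul_assoc)
  qed
  then show ?thesis
    using assms(1) by (simp add: pos_def_def matrix_transpose_mul matrix_mul_assoc)
qed

lemma pos_def_scaleR: "pos_def A \<Longrightarrow> 0 < c \<Longrightarrow> pos_def (c *\<^sub>R A)"
  by (simp add: pos_def_def transpose_scalar scaleR_matrix_vector_assoc[symmetric])

lemma pos_def_mat_1: "pos_def (mat 1)"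
  by (simp add: pos_def_def)

lemma pos_def_add: "pos_def A \<Longrightarrow> pos_def B \<Longrightarrow> pos_def (A + B)"
  by (simp add: pos_def_def transpose_add matrix_vector_simps inner_add_right add_pos_pos)

text \<open>
  In an orthonormal eigenbasis the quadratic form is a sum of squares weighted by the eigenvalues.
\<close>

lemma pos_def_eigenvaluesI:
  fixes A :: "real ^ 'k ^ 'k"
  assumes sym: "transpose A = A"
    and pos: "\<And>v l. v \<noteq> 0 \<Longrightarrow> A *v v = l *\<^sub>R v \<Longrightarrow> 0 < l"
  shows "pos_def A"
proof -
  obtain B where B: "finite B" "pairwise orthogonal B" "\<And>b. b \<in> B \<Longrightarrow> norm b = 1"
    "span B = UNIV" "\<And>b. b \<in> B \<Longrightarrow> A *v b = (b \<bullet> (A *v b)) *\<^sub>R b"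
    using symmetric_orthonormal_eigenbasis[OF sym] by metis
  have expand: "(\<Sum>b\<in>B. (x \<bullet> b) *\<^sub>R b) = x" for x
    using B by (intro orthonormal_basis_expand) auto
  have lpos: "0 < b \<bullet> (A *v b)" if "b \<in> B" for b
    using pos[OF _ B(5)[OF that]] B(3)[OF that] by force
  have "0 < x \<bullet> (A *v x)" if "x \<noteq> 0" for x
  proof -
    have "x \<bullet> (A *v x) = (A *v x) \<bullet> x" by (rule inner_commute)
    also have "\<dots> = (A *v x) \<bullet> (\<Sum>b\<in>B. (x \<bullet> b) *\<^sub>R b)"
      by (rule arg_cong[OF expand[symmetric]])
    also have "\<dots> = (\<Sum>b\<in>B. (x \<bullet> b) * (x \<bullet> (A *v b)))"
      by (simp only: inner_sum_right inner_scaleR_right inner_matrix_vector_left sym)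
    also have "\<dots> = (\<Sum>b\<in>B. (b \<bullet> (A *v b)) * (x \<bullet> b)\<^sup>2)"
    proof (rule sum.cong)
      fix b assume "b \<in> B"
      show "(x \<bullet> b) * (x \<bullet> (A *v b)) = (b \<bullet> (A *v b)) * (x \<bullet> b)\<^sup>2"
        by (subst B(5)[OF \<open>b \<in> B\<close>]) (simp add: power2_eq_square mult_ac)
    qed simp
    also have "\<dots> > 0"
    proof -
      have "\<exists>b\<in>B. x \<bullet> b \<noteq> 0"
      proof (rule ccontr)
        assume "\<not> (\<exists>b\<in>B. x \<bullet> b \<noteq> 0)"
        then have "(\<Sum>b\<in>B. (x \<bullet> b) *\<^sub>R b) = 0" by (intro sum.neutral) auto
        then show False using that by (simp only: expand)
      qed
      then obtain b where "b \<in> B" "x \<bullet> b \<noteq> 0" by blast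
      then show ?thesis using lpos B(1) by (intro sum_pos2[of _ b]) (auto simp: less_imp_le)
    qed
    finally show ?thesis .
  qed
  then show ?thesis using sym by (simp add: pos_def_def)
qed

text \<open>
  The root is the map with the same eigenbasis whose eigenvalues are the square roots.
\<close>

lemma pos_def_sqrt_exists:
  fixes A :: "real ^ 'k ^ 'k"
  assumes "pos_def A"
  shows "\<exists>R. pos_def R \<and> R ** R = A"
proof -
  obtain B where B: "finite B" "pairwise orthogonal B" "\<And>b. b \<in> B \<Longrightarrow> norm b = 1"
    "span B = UNIV" "\<And>b. b \<in> B \<Longrightarrow> A *v b = (b \<bullet> (A *v b)) *\<^sub>R b"
    using symmetric_orthonormal_eigenbasis[OF pos_def_sym[OF assms]] by metis
  have expand: "(\<Sum>b\<in>B. (x \<bullet> b) *\<^sub>R b) = x" for x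
    using B by (intro orthonormal_basis_expand) auto
  define l where "l b = sqrt (b \<bullet> (A *v b))" for b
  have lpos: "0 < b \<bullet> (A *v b)" if "b \<in> B" for b
  proof -
    have "b \<noteq> 0" using B(3)[OF that] by auto
    then show ?thesis using assms by (simp add: pos_def_def)
  qed
  have l: "l b > 0" "b \<bullet> (A *v b) = l b * l b" if "b \<in> B" for b
    using lpos[OF that] by (simp_all add: l_def)
  define f where "f x = (\<Sum>b\<in>B. (l b * (x \<bullet> b)) *\<^sub>R b)" for x
  have "linear f"
    by (simp add: f_def linear_iff inner_add_left sum.distrib algebra_simps scaleR_sum_right)
  define R where "R = matrix f"
  have R: "R *v x = f x" for x using \<open>linear f\<close> by (simp add: R_def)
  have fb: "f b = l b *\<^sub>R b" if "b \<in> B" for b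
  proof -
    have "f b = (\<Sum>c\<in>B. if c = b then l b *\<^sub>R b else 0)"
      unfolding f_def
      using B(2,3) that by (intro sum.cong) (auto simp: pairwise_def orthogonal_def norm_eq_1)
    then show ?thesis using B(1) that by simp
  qed
  have fx: "f (f x) = A *v x" for x
  proof -
    have "f (f x) = f (f (\<Sum>b\<in>B. (x \<bullet> b) *\<^sub>R b))" by (simp add: expand)
    also have "\<dots> = (\<Sum>b\<in>B. (x \<bullet> b) *\<^sub>R f (f b))"
      using \<open>linear f\<close> by (simp add: linear_sum linear_cmul)
    also have "\<dots> = (\<Sum>b\<in>B. (x \<bullet> b) *\<^sub>R (A *v b))"
    proof (rule sum.cong)
      fix b assume b: "b \<in> B"
      have "f (f b) = (l b * l b) *\<^sub>R b" using b \<open>linear f\<close> by (simp add: fb linear_cmul)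
      then show "(x \<bullet> b) *\<^sub>R f (f b) = (x \<bullet> b) *\<^sub>R (A *v b)"
        using B(5)[OF b] l(2)[OF b] by simp
    qed simp
    also have "\<dots> = A *v (\<Sum>b\<in>B. (x \<bullet> b) *\<^sub>R b)"
      by (simp add: linear_sum[OF matrix_vector_mul_linear] matrix_vector_simps)
    finally show ?thesis by (simp add: expand)
  qed
  have "R ** R = A"
    by (simp add: matrix_eq matrix_vector_mul_assoc[symmetric] R fx)
  moreover have "transpose R = R"
    by (intro symmetric_matrixI)
       (simp add: R f_def inner_sum_left inner_sum_right inner_commute mult_ac)
  moreover have "0 < x \<bullet> (R *v x)" if "x \<noteq> 0" for x
  proof -
    have "\<exists>b\<in>B. x \<bullet> b \<noteq> 0"
    proof (rule ccontr)
      assume "\<not> (\<exists>b\<in>B. x \<bullet> b \<noteq> 0)"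
      then have "(\<Sum>b\<in>B. (x \<bullet> b) *\<^sub>R b) = 0" by (intro sum.neutral) auto
      then show False using that by (simp only: expand)
    qed
    then obtain b where "b \<in> B" "x \<bullet> b \<noteq> 0" by blast
    moreover have "x \<bullet> (R *v x) = (\<Sum>b\<in>B. l b * (x \<bullet> b)\<^sup>2)"
      by (simp add: R f_def inner_sum_right power2_eq_square mult_ac)
    ultimately show ?thesis
      using B(1) l(1) by (auto intro!: sum_pos2[of _ b] simp: less_imp_le)
  qed
  ultimately show ?thesis by (auto simp: pos_def_def)
qed

text \<open>
  The difference \<open>E\<close> of two roots is symmetric and satisfies \<open>E R + S E = 0\<close>. Testing this identity
  on a unit eigenvector \<open>b\<close> of \<open>E\<close> with eigenvalue \<open>l\<close> gives \<open>l * (b \<bullet> R b + b \<bullet> S b) = 0\<close>, so every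
  eigenvalue of \<open>E\<close> is zero.
\<close>

lemma pos_def_sqrt_unique:
  assumes R: "pos_def R" and S: "pos_def S" and eq: "R ** R = S ** S"
  shows "R = S"
proof -
  define E where "E = R - S"
  have sym: "transpose E = E" using R S by (simp add: E_def transpose_diff pos_def_sym)
  have comm: "E *v (R *v x) + S *v (E *v x) = 0" for x
  proof -
    have "R *v (R *v x) = S *v (S *v x)"
      using eq by (simp add: matrix_vector_mul_assoc)
    then show ?thesis by (simp add: E_def matrix_vector_simps)
  qed
  obtain B where B: "span B = UNIV" "\<And>b. b \<in> B \<Longrightarrow> norm b = 1"
    "\<And>b. b \<in> B \<Longrightarrow> E *v b = (b \<bullet> (E *v b)) *\<^sub>R b"
    using symmetric_orthonormal_eigenbasis[OF sym] by metis
  have "E *v b = 0" if "b \<in> B" for b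
  proof -
    define l where "l = b \<bullet> (E *v b)"
    have Eb: "E *v b = l *\<^sub>R b" using B(3)[OF that] by (simp add: l_def)
    have "b \<noteq> 0" using B(2)[OF that] by auto
    then have "0 < b \<bullet> (R *v b) + b \<bullet> (S *v b)"
      using R S by (simp add: pos_def_def add_pos_pos)
    moreover have "l * (b \<bullet> (R *v b) + b \<bullet> (S *v b)) = 0"
    proof -
      have "0 = b \<bullet> (E *v (R *v b)) + b \<bullet> (S *v (E *v b))"
        by (metis comm inner_add_right inner_zero_right)
      also have "b \<bullet> (E *v (R *v b)) = (E *v b) \<bullet> (R *v b)"
        using sym by (simp add: inner_matrix_vector_left)
      finally show ?thesis by (simp add: Eb matrix_vector_simps algebra_simps)
    qed
    ultimately show ?thesis by (simp add: Eb)
  qed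
  then have "E *v x = 0" for x
    using linear_eq_0_on_span[OF matrix_vector_mul_linear, of B E x] B(1) by auto
  then show ?thesis by (metis E_def eq_iff_diff_eq_0 matrix_eq matrix_vector_mult_0)
qed

lemma pd_sqrt:
  assumes "pos_def A"
  shows pos_def_pd_sqrt: "pos_def (pd_sqrt A)" and pd_sqrt_squared: "pd_sqrt A ** pd_sqrt A = A"
proof -
  have "\<exists>!R. pos_def R \<and> R ** R = A"
    using pos_def_sqrt_exists[OF assms] pos_def_sqrt_unique by metis
  then have "pos_def (pd_sqrt A) \<and> pd_sqrt A ** pd_sqrt A = A"
    unfolding pd_sqrt_def by (rule theI')
  then show "pos_def (pd_sqrt A)" "pd_sqrt A ** pd_sqrt A = A" by auto
qed

lemma det_pos_def: "pos_def A \<Longrightarrow> 0 < det A"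
proof -
  assume "pos_def A"
  note R = pd_sqrt[OF this]
  have "det A = det (pd_sqrt A) * det (pd_sqrt A)" by (simp add: R(2) flip: det_mul)
  moreover have "det (pd_sqrt A) \<noteq> 0"
    using pos_def_invertible[OF R(1)] by (simp add: invertible_det_nz)
  ultimately show ?thesis by (metis not_real_square_gt_zero)
qed

text \<open>
  An eigenvalue \<open>q > 0\<close> of \<open>Q\<close> satisfies \<open>q\<^sup>2 > c\<^sup>2\<close>, hence \<open>q > c\<close>. This makes the bracket in the
  formula for the optimal cross-covariance positive definite up to similarity.
\<close>

lemma pos_def_diff_scalar:
  fixes Q :: "real ^ 'k ^ 'k"
  assumes Q: "pos_def Q" and D: "pos_def D" and eq: "Q ** Q = D + c\<^sup>2 *\<^sub>R mat 1" and "0 \<le> c"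
  shows "pos_def (Q - c *\<^sub>R mat 1)"
proof (rule pos_def_eigenvaluesI)
  show "transpose (Q - c *\<^sub>R mat 1) = Q - c *\<^sub>R mat 1"
    using Q by (simp add: transpose_diff transpose_scalar pos_def_sym)
  fix v l assume v: "v \<noteq> 0" and "(Q - c *\<^sub>R mat 1) *v v = l *\<^sub>R v"
  then have Qv: "Q *v v = (l + c) *\<^sub>R v"
    by (simp add: matrix_vector_simps algebra_simps)
  have "(Q ** Q) *v v = (l + c)\<^sup>2 *\<^sub>R v"
    by (simp add: matrix_vector_mul_assoc[symmetric] Qv matrix_vector_mult_scaleR power2_eq_square)
  then have "D *v v = (l + c)\<^sup>2 *\<^sub>R v - c\<^sup>2 *\<^sub>R v"
    unfolding eq eq_diff_eq by (simp add: matrix_vector_simps)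
  then have "v \<bullet> (D *v v) = ((l + c)\<^sup>2 - c\<^sup>2) * (v \<bullet> v)"
    by (simp add: inner_diff_right left_diff_distrib)
  moreover have "0 < v \<bullet> (D *v v)" "0 < v \<bullet> v" using D v by (auto simp: pos_def_def)
  ultimately have "c\<^sup>2 < (l + c)\<^sup>2" by (simp add: zero_less_mult_iff)
  moreover have "0 < l + c"
  proof -
    have "0 < v \<bullet> (Q *v v)" using Q v by (auto simp: pos_def_def)
    then show ?thesis using \<open>0 < v \<bullet> v\<close> by (simp add: Qv zero_less_mult_iff)
  qed
  ultimately show "0 < l"
    using \<open>0 \<le> c\<close> by (smt (verit) power_mono)
qed

section \<open>Block matrices\<close>

definition join_vec :: "(real ^ 'n) \<times> (real ^ 'n) \<Rightarrow> real ^ ('n + 'n)" where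
  "join_vec p = (\<chi> i. case i of Inl a \<Rightarrow> fst p $ a | Inr b \<Rightarrow> snd p $ b)"

lemma split_join [simp]: "split_vec (join_vec p) = p"
  by (simp add: split_vec_def join_vec_def vec_eq_iff prod_eq_iff)

lemma join_split [simp]: "join_vec (split_vec z) = z"
  by (simp add: split_vec_def join_vec_def vec_eq_iff split: sum.split)

lemma join_vec_cases: obtains x y where "z = join_vec (x, y)"
  by (metis join_split surj_pair)

lemma join_vec_0 [simp]: "join_vec (0, 0) = 0"
  by (simp add: join_vec_def vec_eq_iff split: sum.split)

lemma join_vec_eq_iff [simp]: "join_vec p = join_vec q \<longleftrightarrow> p = q"
  by (metis split_join)

lemma sum_UNIV_sum: "(\<Sum>i\<in>(UNIV :: ('a::finite + 'b::finite) set). f i) =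
  (\<Sum>a\<in>UNIV. f (Inl a)) + (\<Sum>b\<in>UNIV. f (Inr b))"
  by (subst UNIV_Plus_UNIV[symmetric], subst sum.Plus) auto

lemma inner_join_vec [simp]: "join_vec p \<bullet> join_vec q = p \<bullet> q"
  by (simp add: inner_vec_def join_vec_def sum_UNIV_sum inner_prod_def)

lemma block_matrix_vec [simp]:
  "block_matrix P Q R S *v join_vec (x, y) = join_vec (P *v x + Q *v y, R *v x + S *v y)"
  by (simp add: vec_eq_iff matrix_vector_mult_def sum_UNIV_sum block_matrix_def join_vec_def
      split: sum.split)

lemma transpose_block_matrix:
  "transpose (block_matrix P Q R S) =
    block_matrix (transpose P) (transpose R) (transpose Q) (transpose S)"
  by (simp add: vec_eq_iff transpose_def block_matrix_def split: sum.split)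

lemma block_matrix_mult:
  "block_matrix P Q R S ** block_matrix P' Q' R' S' =
    block_matrix (P ** P' + Q ** R') (P ** Q' + Q ** S') (R ** P' + S ** R') (R ** Q' + S ** S')"
  by (simp add: vec_eq_iff matrix_matrix_mult_def sum_UNIV_sum block_matrix_def split: sum.split)

lemma block12_block_matrix [simp]: "block12 (block_matrix P Q R S) = Q"
  by (simp add: block12_def block_matrix_def vec_eq_iff)

lemma block_matrix_cases:
  obtains P Q R S where "G = block_matrix P Q R S"
proof
  show "G = block_matrix (\<chi> i j. G $ Inl i $ Inl j) (\<chi> i j. G $ Inl i $ Inr j)
    (\<chi> i j. G $ Inr i $ Inl j) (\<chi> i j. G $ Inr i $ Inr j)"
    by (simp add: vec_eq_iff block_matrix_def split: sum.split)
qed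

lemma block_matrix_eq_iff:
  "block_matrix P Q R S = block_matrix P' Q' R' S' \<longleftrightarrow> P = P' \<and> Q = Q' \<and> R = R' \<and> S = S'"
proof
  assume eq: "block_matrix P Q R S = block_matrix P' Q' R' S'"
  have "block_matrix P Q R S *v join_vec (x, y) = block_matrix P' Q' R' S' *v join_vec (x, y)" for x y
    by (simp only: eq)
  from this[of _ 0] this[of 0] show "P = P' \<and> Q = Q' \<and> R = R' \<and> S = S'"
    by (simp add: matrix_eq)
qed simp

text \<open>
  Only the off-diagonal block couples the two variables. The diagonal blocks enter the transport
  problem through functions of \<open>x\<close> alone or of \<open>y\<close> alone, so they are left unnamed.
\<close>

lemma symmetric_quadratic_form_blocks:
  assumes "transpose G = G"
  obtains P S where "\<And>x y. join_vec (x, y) \<bullet> (G *v join_vec (x, y)) =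
    x \<bullet> (P *v x) + y \<bullet> (S *v y) + 2 * (x \<bullet> (block12 G *v y))"
proof -
  obtain P Q R S where G: "G = block_matrix P Q R S" by (rule block_matrix_cases)
  have R: "R = transpose Q"
    using assms by (simp add: G transpose_block_matrix block_matrix_eq_iff)
  show thesis
  proof
    fix x y
    have "y \<bullet> (R *v x) = x \<bullet> (Q *v y)"
      using inner_matrix_vector_left[of Q y x] by (simp add: R inner_commute)
    then show "join_vec (x, y) \<bullet> (G *v join_vec (x, y)) =
      x \<bullet> (P *v x) + y \<bullet> (S *v y) + 2 * (x \<bullet> (block12 G *v y))"
      by (simp add: G inner_add_right)
  qed
qed

section \<open>Schur complements\<close>

text \<open>
  The Schur complement of the first diagonal block in the symmetric block matrix with blocks \<open>A\<close>, \<open>C\<close>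
  and \<open>B\<close>; it is the conditional covariance of the second component given the first.
\<close>

definition schur :: "real ^ 'n ^ 'n \<Rightarrow> real ^ 'n ^ 'n \<Rightarrow> real ^ 'n ^ 'n \<Rightarrow> real ^ 'n ^ 'n" where
  "schur A C B = B - transpose C ** matrix_inv A ** C"

lemma transpose_schur:
  assumes "pos_def A" "transpose B = B"
  shows "transpose (schur A C B) = schur A C B"
  using assms pos_def_sym[OF pos_def_matrix_inv[OF assms(1)]]
  by (simp add: schur_def transpose_diff matrix_transpose_mul matrix_mul_assoc)

lemma block_quadratic_form_complete_square:
  fixes A B C :: "real ^ 'n ^ 'n"
  assumes A: "pos_def A"
  shows "join_vec (x, y) \<bullet> (block_matrix A C (transpose C) B *v join_vec (x, y)) =
    (x + matrix_inv A *v (C *v y)) \<bullet> (A *v (x + matrix_inv A *v (C *v y))) +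
    y \<bullet> (schur A C B *v y)"
proof -
  note inv = matrix_inv_cancel[OF pos_def_invertible[OF A]]
  let ?u = "matrix_inv A *v (C *v y)"
  have 1: "?u \<bullet> (A *v x) = x \<bullet> (C *v y)"
    by (metis inv(1) inner_commute pos_def_inner[OF A])
  have 2: "y \<bullet> (transpose C *v w) = w \<bullet> (C *v y)" for w
    by (metis inner_matrix_vector_left inner_commute)
  show ?thesis
    by (simp add: schur_def matrix_vector_simps inner_add_left inner_add_right inner_diff_right
        inv 1 2 del: transpose_matrix_vector)
qed

lemma pos_def_block_iff:
  fixes A B C :: "real ^ 'n ^ 'n"
  shows "pos_def (block_matrix A C (transpose C) B) \<longleftrightarrow> pos_def A \<and> pos_def (schur A C B)"
    (is "pos_def ?S \<longleftrightarrow> _")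
proof
  assume S: "pos_def ?S"
  then have sym: "transpose A = A" "transpose B = B"
    by (auto dest!: pos_def_sym simp: transpose_block_matrix block_matrix_eq_iff)
  have pos: "0 < join_vec (x, y) \<bullet> (?S *v join_vec (x, y))" if "(x, y) \<noteq> 0" for x y
    using S that unfolding pos_def_def by (metis join_vec_0 join_vec_eq_iff zero_prod_def)
  have "0 < x \<bullet> (A *v x)" if "x \<noteq> 0" for x
    using pos[of x 0] that by (simp add: zero_prod_def)
  then have A: "pos_def A" using sym by (simp add: pos_def_def)
  have "0 < y \<bullet> (schur A C B *v y)" if "y \<noteq> 0" for y
    using pos[of "- (matrix_inv A *v (C *v y))" y] that
    unfolding block_quadratic_form_complete_square[OF A] by (simp add: zero_prod_def)
  then show "pos_def A \<and> pos_def (schur A C B)"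
    using A sym by (simp add: pos_def_def transpose_schur)
next
  assume *: "pos_def A \<and> pos_def (schur A C B)"
  then have A: "pos_def A" and sch: "pos_def (schur A C B)" by auto
  have "B = schur A C B + transpose C ** matrix_inv A ** C" by (simp add: schur_def)
  moreover have "transpose \<dots> = \<dots>"
    using A sch pos_def_sym[OF pos_def_matrix_inv[OF A]]
    by (simp add: transpose_add matrix_transpose_mul matrix_mul_assoc pos_def_sym)
  ultimately have B: "transpose B = B" by simp
  have "0 < z \<bullet> (?S *v z)" if "z \<noteq> 0" for z
  proof -
    obtain x y where z: "z = join_vec (x, y)" by (rule join_vec_cases)
    show ?thesis
    proof (cases "y = 0")
      case True
      then have "x \<noteq> 0" using that by (auto simp: z)
      then show ?thesis using A True by (simp add: z pos_def_def)
    next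
      case False
      have "0 \<le> w \<bullet> (A *v w)" for w using A by (cases "w = 0") (auto simp: pos_def_def less_imp_le)
      moreover have "0 < y \<bullet> (schur A C B *v y)" using sch False by (auto simp: pos_def_def)
      ultimately show ?thesis
        unfolding z block_quadratic_form_complete_square[OF A] by (simp add: add_nonneg_pos)
    qed
  qed
  then show "pos_def ?S" using A B by (simp add: pos_def_def transpose_block_matrix)
qed

text \<open>
  A block Cholesky factorization. The factor is lower triangular, so the first component of its image
  depends on the first component of the argument only; this reads off the first marginal of a Gaussian
  measure written as a linear image of the standard one.
\<close>

lemma block_factorization:
  fixes A B C :: "real ^ 'n ^ 'n"
  assumes "pos_def (block_matrix A C (transpose C) B)"
  obtains R X T where "R ** transpose R = A"
    "block_matrix R 0 X T ** transpose (block_matrix R 0 X T) = block_matrix A C (transpose C) B"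
proof -
  have A: "pos_def A" and sch: "pos_def (schur A C B)" using assms by (auto simp: pos_def_block_iff)
  define R where "R = pd_sqrt A"
  define T where "T = pd_sqrt (schur A C B)"
  define X where "X = transpose C ** matrix_inv R"
  have R: "pos_def R" "R ** R = A" and T: "pos_def T" "T ** T = schur A C B"
    using pd_sqrt[OF A] pd_sqrt[OF sch] by (auto simp: R_def T_def)
  note inv = matrix_inv_cancel[OF pos_def_invertible[OF R(1)]]
  note symR = pos_def_sym[OF R(1)] pos_def_sym[OF pos_def_matrix_inv[OF R(1)]]
  have A_inv: "matrix_inv A *v x = matrix_inv R *v (matrix_inv R *v x)" for x
  proof -
    have "A *v (matrix_inv R *v (matrix_inv R *v x)) = x"
      by (simp add: R(2)[symmetric] matrix_vector_mul_assoc[symmetric] inv)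
    then show ?thesis by (metis matrix_inv_cancel(2)[OF pos_def_invertible[OF A]])
  qed
  have "R ** transpose X = C"
    by (simp add: X_def symR matrix_transpose_mul matrix_eq matrix_vector_mul_assoc[symmetric] inv)
  moreover from this have "X ** transpose R = transpose C"
    by (metis matrix_transpose_mul transpose_transpose)
  moreover have "X ** transpose X + T ** transpose T = B"
    by (simp add: X_def pos_def_sym[OF T(1)] T(2) symR matrix_transpose_mul matrix_eq
        matrix_vector_simps schur_def A_inv del: transpose_matrix_vector)
  ultimately show thesis
    using symR(1) R(2)
    by (intro that[of R X T])
       (simp_all add: transpose_block_matrix block_matrix_mult transpose_def[of "0 :: real^'n^'n"]
         zero_vec_def[symmetric])
qed

lemma pos_def_block_swap:
  assumes "pos_def (block_matrix A C (transpose C) B)"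
  shows "pos_def (block_matrix B (transpose C) C A)"
proof -
  have "0 < z \<bullet> (block_matrix B (transpose C) C A *v z)" if "z \<noteq> 0" for z
  proof -
    obtain x y where z: "z = join_vec (x, y)" by (rule join_vec_cases)
    have "join_vec (y, x) \<noteq> 0" using that by (metis z join_vec_0 join_vec_eq_iff prod.inject)
    then have "0 < join_vec (y, x) \<bullet> (block_matrix A C (transpose C) B *v join_vec (y, x))"
      using assms unfolding pos_def_def by blast
    then show ?thesis by (simp add: z add_ac)
  qed
  moreover have "transpose A = A \<and> transpose B = B"
    using pos_def_sym[OF assms] by (simp add: transpose_block_matrix block_matrix_eq_iff)
  ultimately show ?thesis by (simp add: pos_def_def transpose_block_matrix)
qed

text \<open>
  The upper triangular counterpart serves the second marginal.
\<close>

lemma block_factorization_upper: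
  fixes A B C :: "real ^ 'n ^ 'n"
  assumes "pos_def (block_matrix A C (transpose C) B)"
  obtains R X T where "R ** transpose R = B"
    "block_matrix T X 0 R ** transpose (block_matrix T X 0 R) = block_matrix A C (transpose C) B"
proof -
  have "pos_def (block_matrix B (transpose C) (transpose (transpose C)) A)"
    using pos_def_block_swap[OF assms] by simp
  from block_factorization[OF this] obtain R X T where R: "R ** transpose R = B" and
    eq: "block_matrix R 0 X T ** transpose (block_matrix R 0 X T) =
      block_matrix B (transpose C) (transpose (transpose C)) A" by blast
  have "transpose (0 :: real ^ 'n ^ 'n) = 0" by (simp add: transpose_def vec_eq_iff)
  then have "block_matrix T X 0 R ** transpose (block_matrix T X 0 R) =
      block_matrix A C (transpose C) B"
    using eq by (simp add: transpose_block_matrix block_matrix_mult block_matrix_eq_iff add.commute)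
  with R show thesis by (rule that)
qed

text \<open>
  The second block column of the inverse is found by solving the block system for the right-hand side
  \<open>(0, y)\<close>: eliminating the first unknown leaves \<open>schur A C B *v v = y\<close>.
\<close>

lemma block12_matrix_inv:
  fixes A B C N :: "real ^ 'n ^ 'n"
  assumes S: "pos_def (block_matrix A C (transpose C) B)"
    and N: "N ** schur A C B = - (matrix_inv A ** C)"
  shows "block12 (matrix_inv (block_matrix A C (transpose C) B)) = N"
proof -
  let ?S = "block_matrix A C (transpose C) B"
  have A: "pos_def A" and sch: "pos_def (schur A C B)" using S by (auto simp: pos_def_block_iff)
  note invA = matrix_inv_cancel[OF pos_def_invertible[OF A]]
    and invSch = matrix_inv_cancel[OF pos_def_invertible[OF sch]]
    and invS = matrix_inv_cancel[OF pos_def_invertible[OF S]]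
  obtain P Q R T where inv: "matrix_inv ?S = block_matrix P Q R T" by (rule block_matrix_cases)
  have "Q *v y = N *v y" for y
  proof -
    define v where "v = matrix_inv (schur A C B) *v y"
    define u where "u = - (matrix_inv A *v (C *v v))"
    have neg: "D *v (- w) = - (D *v w)" for D :: "real ^ 'n ^ 'n" and w
      by (simp add: linear_neg)
    have neg': "(- D) *v w = - (D *v w)" for D :: "real ^ 'n ^ 'n" and w
      by (simp add: matrix_vector_mult_def vec_eq_iff sum_negf)
    have "transpose C *v u + B *v v = schur A C B *v v"
      by (simp add: u_def schur_def matrix_vector_simps neg del: transpose_matrix_vector)
    then have "?S *v join_vec (u, v) = join_vec (0, y)"
      by (simp add: v_def invSch) (simp add: u_def v_def neg invA)
    then have "matrix_inv ?S *v join_vec (0, y) = join_vec (u, v)" by (metis invS(2))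
    then have "Q *v y = u" by (simp add: inv)
    also have "u = (N ** schur A C B) *v v"
      by (simp add: N u_def neg' matrix_vector_mul_assoc[symmetric])
    also have "\<dots> = N *v y" by (simp add: matrix_vector_mul_assoc[symmetric] v_def invSch)
    finally show ?thesis .
  qed
  then show ?thesis by (simp add: inv matrix_eq)
qed

section \<open>The equation for the optimal cross-covariance\<close>

lemma matrix_inv_transpose:
  fixes M :: "real ^ 'n ^ 'n"
  assumes "invertible M"
  shows "matrix_inv (transpose M) = transpose (matrix_inv M)"
proof -
  have "transpose M *v (transpose (matrix_inv M) *v x) = x" for x
    using matrix_inv_mult[OF assms]
    by (metis matrix_transpose_mul matrix_vector_mul_assoc matrix_vector_mul_lid transpose_mat)
  then show ?thesis
    unfolding matrix_eq by (metis matrix_inv_cancel(2)[OF transpose_invertible[OF assms]])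
qed

text \<open>
  The cross-covariance of the theorem satisfies the equation that prescribes the off-diagonal
  block of the inverse covariance. With \<open>R\<close> the root of \<open>A\<close>, \<open>P = M B M\<^sup>T\<close>, \<open>Q\<close> the root of
  \<open>R P R + (\<epsilon> / 2)\<^sup>2 I\<close> and \<open>E = Q - (\<epsilon> / 2) I\<close>, the matrix is \<open>C = R E R\<^sup>-\<^sup>1 (M\<^sup>T)\<^sup>-\<^sup>1\<close>. Squaring \<open>Q\<close> gives
  \<open>E\<^sup>2 + \<epsilon> E = R P R\<close>, and conjugating with \<open>R\<^sup>-\<^sup>1\<close> and \<open>M\<^sup>-\<^sup>1\<close> turns this into
  \<open>schur A C B = \<epsilon> M\<^sup>-\<^sup>1 R\<^sup>-\<^sup>1 E R\<^sup>-\<^sup>1 (M\<^sup>T)\<^sup>-\<^sup>1\<close>, from which both claims can be read off.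
\<close>

lemma coupling_schur_equation:
  fixes A B M :: "real ^ 'n ^ 'n" and \<epsilon> :: real
  defines "C \<equiv> (twisted_sqrt A (M ** B ** transpose M) (\<epsilon>\<^sup>2 / 4) - (\<epsilon> / 2) *\<^sub>R mat 1)
                ** matrix_inv (transpose M)"
  assumes A: "pos_def A" and B: "pos_def B" and "\<epsilon> > 0" and M: "invertible M"
  shows "pos_def (schur A C B)" and "M ** schur A C B = \<epsilon> *\<^sub>R (matrix_inv A ** C)"
proof -
  define P where "P = M ** B ** transpose M"
  define R where "R = pd_sqrt A"
  define D where "D = R ** P ** R"
  define Q where "Q = pd_sqrt (D + (\<epsilon> / 2)\<^sup>2 *\<^sub>R mat 1)"
  define E where "E = Q - (\<epsilon> / 2) *\<^sub>R mat 1"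
  have R: "pos_def R" "R ** R = A" using pd_sqrt[OF A] by (auto simp: R_def)
  note invR = matrix_inv_cancel[OF pos_def_invertible[OF R(1)]]
    and symR = pos_def_sym[OF R(1)] pos_def_sym[OF pos_def_matrix_inv[OF R(1)]]
    and invM = matrix_inv_cancel[OF M]
    and invMT = matrix_inv_cancel[OF transpose_invertible[OF M]]
  have P: "pos_def P" unfolding P_def by (rule pos_def_congruence[OF B M])
  have D: "pos_def D"
    using pos_def_congruence[OF P pos_def_invertible[OF R(1)]] by (simp add: D_def symR)
  have "pos_def (D + (\<epsilon> / 2)\<^sup>2 *\<^sub>R mat 1)"
    using \<open>\<epsilon> > 0\<close> by (intro pos_def_add D pos_def_scaleR pos_def_mat_1) simp
  then have Q: "pos_def Q" "Q ** Q = D + (\<epsilon> / 2)\<^sup>2 *\<^sub>R mat 1" using pd_sqrt by (auto simp: Q_def)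
  have E: "pos_def E"
    unfolding E_def using \<open>\<epsilon> > 0\<close> by (intro pos_def_diff_scalar[OF Q(1) D Q(2)]) simp
  have EE: "E *v (E *v x) = R *v (P *v (R *v x)) - \<epsilon> *\<^sub>R (E *v x)" for x
  proof -
    have "Q *v (Q *v x) = R *v (P *v (R *v x)) + (\<epsilon> / 2)\<^sup>2 *\<^sub>R x"
      using arg_cong[OF Q(2), of "\<lambda>Z. Z *v x"] by (simp add: D_def matrix_vector_simps)
    then show ?thesis
      by (simp add: E_def matrix_vector_simps algebra_simps power2_eq_square
          flip: scaleR_add_left)
  qed
  have C: "C = R ** E ** matrix_inv R ** matrix_inv (transpose M)"
    by (simp add: C_def twisted_sqrt_def matrix_eq matrix_vector_simps E_def Q_def D_def P_def R_def
        power_divide invR[unfolded R_def] del: transpose_matrix_vector)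
  have CT: "transpose C = matrix_inv M ** matrix_inv R ** E ** R"
    by (simp add: C matrix_inv_transpose[OF M] matrix_transpose_mul symR pos_def_sym[OF E] matrix_mul_assoc)
  have A_inv: "matrix_inv A *v x = matrix_inv R *v (matrix_inv R *v x)" for x
  proof -
    have "A *v (matrix_inv R *v (matrix_inv R *v x)) = x"
      by (simp add: R(2)[symmetric] matrix_vector_mul_assoc[symmetric] invR)
    then show ?thesis by (metis matrix_inv_cancel(2)[OF pos_def_invertible[OF A]])
  qed
  have schur: "schur A C B = matrix_inv M ** (\<epsilon> *\<^sub>R (matrix_inv R ** E ** matrix_inv R)) **
    transpose (matrix_inv M)"
    unfolding CT schur_def
    by (simp add: C matrix_eq matrix_vector_simps A_inv invR EE invM invMT P_def
        flip: matrix_inv_transpose[OF M]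
        del: transpose_matrix_vector)
  have "pos_def (matrix_inv R ** E ** matrix_inv R)"
    using pos_def_congruence[OF E invertible_matrix_inv[OF pos_def_invertible[OF R(1)]]]
    by (simp add: symR)
  then show "pos_def (schur A C B)"
    unfolding schur using \<open>\<epsilon> > 0\<close>
    by (intro pos_def_congruence pos_def_scaleR invertible_matrix_inv M)
  show "M ** schur A C B = \<epsilon> *\<^sub>R (matrix_inv A ** C)"
    unfolding schur
    by (simp add: C matrix_eq matrix_vector_simps A_inv invR invM
        flip: matrix_inv_transpose[OF M] del: transpose_matrix_vector)
qed

section \<open>Linear changes of variables\<close>

lemma nn_integral_lborel_translate:
  fixes c :: "'a::euclidean_space"
  assumes "g \<in> borel_measurable borel"
  shows "(\<integral>\<^sup>+x. g (c + x) \<partial>lborel) = (\<integral>\<^sup>+x. g x \<partial>lborel)"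
  using assms by (subst (2) lborel_distr_plus[symmetric, of c]) (simp add: nn_integral_distr)

text \<open>
  The image measure is translation invariant, hence proportional to Lebesgue measure; the factor is 1
  because a suitable bounded neighbourhood \<open>K\<close> of the origin is mapped to itself, by the map and by
  negation. The uniqueness argument and the normalization are done at once: both sides multiplied by the measure of \<open>K\<close> are the same double
  integral, evaluated in the two orders of integration after translations.
\<close>

lemma lborel_distr_linear_involution:
  fixes f :: "'a::euclidean_space \<Rightarrow> 'a"
  assumes lin: "linear f" and inv: "\<And>x. f (f x) = x"
  shows "distr lborel borel f = lborel"
proof (rule measure_eqI)
  have cont: "continuous_on UNIV f"
    using lin by (intro linear_continuous_on) (simp add: linear_conv_bounded_linear)
  then have [measurable]: "f \<in> borel_measurable borel"
    by (rule borel_measurable_continuous_onI)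
  define K :: "'a set" where "K = ball 0 1 \<inter> f -` ball 0 1"
  have "open K" unfolding K_def by (intro open_Int open_ball open_vimage cont)
  then have [measurable]: "K \<in> sets borel" by simp
  have fK: "f x \<in> K \<longleftrightarrow> x \<in> K" for x by (auto simp: K_def inv)
  have minusK: "- x \<in> K \<longleftrightarrow> x \<in> K" for x by (auto simp: K_def linear_neg[OF lin])
  have "0 \<in> K" by (simp add: K_def linear_0[OF lin])
  then obtain e where "0 < e" "ball 0 e \<subseteq> K" using \<open>open K\<close> open_contains_ball by blast
  then have "emeasure lborel (ball (0::'a) e) \<le> emeasure lborel K"
    by (intro emeasure_mono) auto
  moreover have "0 < emeasure lborel (ball (0::'a) e)" using \<open>0 < e\<close> by (simp add: emeasure_ball)
  ultimately have K0: "emeasure lborel K \<noteq> 0" by auto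
  have "bounded K" unfolding K_def by (intro bounded_Int) auto
  from emeasure_bounded_finite[OF this] have Kfin: "emeasure lborel K \<noteq> \<infinity>" by simp
  fix A assume "A \<in> sets (distr lborel borel f)"
  then have [measurable]: "A \<in> sets borel" by simp
  have [measurable]: "(indicator A :: 'a \<Rightarrow> ennreal) \<in> borel_measurable borel"
    "(indicator K :: 'a \<Rightarrow> ennreal) \<in> borel_measurable borel" by auto
  have "emeasure (distr lborel borel f) A = (\<integral>\<^sup>+x. indicator A (f x) \<partial>lborel)"
    by (subst nn_integral_indicator[symmetric]) (auto simp: nn_integral_distr simp del: nn_integral_indicator)
  then have "emeasure (distr lborel borel f) A * emeasure lborel K =
    (\<integral>\<^sup>+y. indicator K y * (\<integral>\<^sup>+x. indicator A (f x) \<partial>lborel) \<partial>lborel)"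
    by (simp add: nn_integral_multc mult.commute)
  also have "\<dots> = (\<integral>\<^sup>+y. (\<integral>\<^sup>+x. indicator K y * indicator A (f x + y) \<partial>lborel) \<partial>lborel)"
  proof (rule nn_integral_cong)
    fix y
    have "(\<integral>\<^sup>+x. indicator A (f x) \<partial>lborel) = (\<integral>\<^sup>+x. indicator A (f (f y + x)) \<partial>lborel)"
      by (subst nn_integral_lborel_translate[of "\<lambda>x. indicator A (f x)"]) auto
    also have "\<dots> = (\<integral>\<^sup>+x. indicator A (f x + y) \<partial>lborel)"
      by (simp add: linear_add[OF lin] inv add.commute)
    finally show "indicator K y * (\<integral>\<^sup>+x. indicator A (f x) \<partial>lborel) =
      (\<integral>\<^sup>+x. indicator K y * indicator A (f x + y) \<partial>lborel)"
      by (simp add: nn_integral_cmult)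
  qed
  also have "\<dots> = (\<integral>\<^sup>+x. (\<integral>\<^sup>+y. indicator K y * indicator A (f x + y) \<partial>lborel) \<partial>lborel)"
    by (rule lborel_pair.Fubini') simp
  also have "\<dots> = (\<integral>\<^sup>+x. (\<integral>\<^sup>+y. indicator K (y - f x) * indicator A y \<partial>lborel) \<partial>lborel)"
  proof (rule nn_integral_cong)
    fix x
    show "(\<integral>\<^sup>+y. indicator K y * indicator A (f x + y) \<partial>lborel) =
      (\<integral>\<^sup>+y. indicator K (y - f x) * indicator A y \<partial>lborel)"
      by (subst nn_integral_lborel_translate[of "\<lambda>y. indicator K (y - f x) * indicator A y" "f x", symmetric])
         auto
  qed
  also have "\<dots> = (\<integral>\<^sup>+y. (\<integral>\<^sup>+x. indicator K (y - f x) * indicator A y \<partial>lborel) \<partial>lborel)"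
    by (rule lborel_pair.Fubini'[symmetric]) simp
  also have "\<dots> = (\<integral>\<^sup>+y. emeasure lborel K * indicator A y \<partial>lborel)"
  proof (rule nn_integral_cong)
    fix y
    have "(\<integral>\<^sup>+x. indicator K (y - f x) \<partial>lborel) = (\<integral>\<^sup>+x. indicator K (- f y + x) \<partial>lborel)"
    proof (rule nn_integral_cong)
      fix x
      have "y - f x \<in> K \<longleftrightarrow> f (y - f x) \<in> K" by (simp add: fK)
      also have "\<dots> \<longleftrightarrow> - (- f y + x) \<in> K" by (simp add: linear_diff[OF lin] inv)
      also have "\<dots> \<longleftrightarrow> - f y + x \<in> K" by (rule minusK)
      finally show "indicator K (y - f x) = (indicator K (- f y + x) :: ennreal)"
        by (simp add: indicator_def)
    qed
    also have "\<dots> = emeasure lborel K"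
      by (subst nn_integral_lborel_translate) auto
    finally show "(\<integral>\<^sup>+x. indicator K (y - f x) * indicator A y \<partial>lborel) =
      emeasure lborel K * indicator A y"
      by (simp add: nn_integral_multc)
  qed
  also have "\<dots> = emeasure lborel A * emeasure lborel K"
    by (subst nn_integral_cmult_indicator) (auto simp: mult.commute)
  finally show "emeasure (distr lborel borel f) A = emeasure lborel A"
    using K0 Kfin by (metis ennreal_mult_divide_eq infinity_ennreal_def)
qed simp

text \<open>
  Singular maps satisfy the predicate vacuously; this keeps it closed under composition while
  the induction over elementary maps also runs through singular ones.
\<close>

definition scales_lborel :: "(real ^ 'k \<Rightarrow> real ^ 'k) \<Rightarrow> bool" where
  "scales_lborel f \<longleftrightarrow> (det (matrix f) \<noteq> 0 \<longrightarrow>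
     lborel = density (distr lborel borel f) (\<lambda>_. ennreal \<bar>det (matrix f)\<bar>))"

lemma borel_measurable_linear:
  "linear f \<Longrightarrow> (f :: 'a::euclidean_space \<Rightarrow> 'b::euclidean_space) \<in> borel_measurable borel"
  by (intro borel_measurable_continuous_onI linear_continuous_on)
     (simp add: linear_conv_bounded_linear)

lemma scales_lborel_involution:
  assumes lin: "linear f" and inv: "\<And>x. f (f x) = x"
  shows "scales_lborel f"
proof -
  have "matrix f ** matrix f = matrix (f \<circ> f)"
    using lin by (simp add: matrix_compose)
  also have "f \<circ> f = id" using inv by (simp add: fun_eq_iff)
  finally have "matrix f ** matrix f = mat 1" by (simp only: matrix_id_mat_1)
  from arg_cong[OF this, of det] have "det (matrix f) * det (matrix f) = 1" by (simp add: det_mul)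
  then have "\<bar>det (matrix f)\<bar> = 1" by (metis abs_mult_self_eq abs_1 abs_square_eq_1 power2_eq_square)
  then show ?thesis
    by (simp add: scales_lborel_def lborel_distr_linear_involution[OF assms] density_1)
qed

lemma scales_lborel_compose:
  assumes lin: "linear f" "linear g" and sc: "scales_lborel f" "scales_lborel g"
  shows "scales_lborel (f \<circ> g)"
  unfolding scales_lborel_def
proof
  note [measurable] = lin[THEN borel_measurable_linear]
  have det: "det (matrix (f \<circ> g)) = det (matrix f) * det (matrix g)"
    using lin by (simp add: matrix_compose det_mul)
  assume "det (matrix (f \<circ> g)) \<noteq> 0"
  then have f: "lborel = density (distr lborel borel f) (\<lambda>_. ennreal \<bar>det (matrix f)\<bar>)"
    and g: "lborel = density (distr lborel borel g) (\<lambda>_. ennreal \<bar>det (matrix g)\<bar>)"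
    using sc by (auto simp: det scales_lborel_def)
  have "lborel = density (distr (density (distr lborel borel g) (\<lambda>_. ennreal \<bar>det (matrix g)\<bar>)) borel f)
    (\<lambda>_. ennreal \<bar>det (matrix f)\<bar>)"
    using f by (simp flip: g)
  also have "\<dots> = density (density (distr (distr lborel borel g) borel f)
    (\<lambda>_. ennreal \<bar>det (matrix g)\<bar>)) (\<lambda>_. ennreal \<bar>det (matrix f)\<bar>)"
    by (subst density_distr) auto
  also have "\<dots> = density (distr lborel borel (f \<circ> g)) (\<lambda>_. ennreal \<bar>det (matrix (f \<circ> g))\<bar>)"
    by (subst density_density_eq)
       (auto simp: distr_distr det abs_mult ennreal_mult mult.commute)
  finally show "lborel = \<dots>" .
qed

text \<open>
  Every linear map is composed of coordinate scalings, transpositions and shears. Transpositions are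
  involutions, and a shear is the product of two involutions: itself followed by a reflection of the
  sheared coordinate, and that reflection.
\<close>

theorem lborel_linear_image:
  fixes f :: "real ^ 'k \<Rightarrow> real ^ 'k"
  assumes "linear f" "det (matrix f) \<noteq> 0"
  shows "lborel = density (distr lborel borel f) (\<lambda>_. ennreal \<bar>det (matrix f)\<bar>)"
proof -
  have "scales_lborel f"
  proof (rule induct_linear_elementary[where P = scales_lborel, OF assms(1) scales_lborel_compose])
    fix f :: "real ^ 'k \<Rightarrow> real ^ 'k" and i
    assume "linear f" "\<And>x. f x $ i = 0"
    then have "row i (matrix f) = 0"
      by (simp add: row_def matrix_def vec_eq_iff)
    then show "scales_lborel f" by (simp add: scales_lborel_def det_zero_row)
  next
    fix c :: "'k \<Rightarrow> real"
    let ?f = "\<lambda>x. (\<chi> i. c i * x $ i) :: real ^ 'k"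
    have mat: "matrix ?f = (\<chi> i j. if i = j then c i else 0)"
      by (auto simp: matrix_def vec_eq_iff axis_def)
    then have det: "det (matrix ?f) = (\<Prod>i\<in>UNIV. c i)" by (simp add: det_diagonal)
    show "scales_lborel ?f"
      unfolding scales_lborel_def
    proof
      assume "det (matrix ?f) \<noteq> 0"
      then have c: "c i \<noteq> 0" for i by (simp add: det)
      define c' where "c' b = c (SOME i. b = axis i 1)" for b :: "real ^ 'k"
      have c': "c' (axis i 1) = c i" for i
        by (simp add: c'_def axis_eq_axis)
      have Basis: "Basis = (\<lambda>i. axis i (1::real) :: real ^ 'k) ` UNIV" by (auto simp: Basis_vec_def)
      have inj: "inj (\<lambda>i. axis i (1::real) :: real ^ 'k)" by (auto simp: inj_def axis_eq_axis)
      have ax: "axis j (1::real) $ i = (if i = j then 1 else 0)" for i j :: 'k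
        by (simp add: axis_def)
      have "?f x = 0 + (\<Sum>j\<in>Basis. (c' j * (x \<bullet> j)) *\<^sub>R j)" for x
        unfolding Basis sum.reindex[OF inj]
        by (simp add: vec_eq_iff c' inner_axis ax if_distrib cong: if_cong)
      moreover have "\<bar>det (matrix ?f)\<bar> = (\<Prod>j\<in>Basis. \<bar>c' j\<bar>)"
        unfolding Basis prod.reindex[OF inj] by (simp add: det c' abs_prod)
      moreover have "c' j \<noteq> 0" if "j \<in> Basis" for j
        using that c by (auto simp: Basis c')
      note lborel_affine_euclidean[of c' 0, OF this]
      ultimately show "lborel = density (distr lborel borel ?f) (\<lambda>_. ennreal \<bar>det (matrix ?f)\<bar>)"
        by (simp only:)
    qed
  next
    fix m n :: 'k
    show "scales_lborel (\<lambda>x. \<chi> i. x $ Transposition.transpose m n i)"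
      by (intro scales_lborel_involution) (auto simp: linear_iff vec_eq_iff)
  next
    fix m n :: 'k assume "m \<noteq> n"
    \<comment> \<open>The reflection of coordinate \<open>m\<close>, and the shear followed by this reflection.\<close>
    let ?D = "\<lambda>x. (\<chi> i. if i = m then - (x $ m) else x $ i) :: real ^ 'k"
    let ?DT = "\<lambda>x. (\<chi> i. if i = m then - (x $ m + x $ n) else x $ i) :: real ^ 'k"
    have lin: "linear ?D" "linear ?DT" by (auto simp: linear_iff vec_eq_iff algebra_simps)
    have "scales_lborel (?D \<circ> ?DT)"
      using lin \<open>m \<noteq> n\<close>
      by (intro scales_lborel_compose scales_lborel_involution) (auto simp: vec_eq_iff)
    also have "?D \<circ> ?DT = (\<lambda>x. \<chi> i. if i = m then x $ m + x $ n else x $ i)"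
      by (auto simp: fun_eq_iff vec_eq_iff)
    finally show "scales_lborel (\<lambda>x. \<chi> i. if i = m then x $ m + x $ n else x $ i)" .
  qed auto
  then show ?thesis using assms by (simp add: scales_lborel_def)
qed

section \<open>Gaussian measures as linear images of the standard one\<close>

lemma borel_measurable_gaussian_density [measurable]: "gaussian_density A \<in> borel_measurable borel"
proof (rule borel_measurable_continuous_onI)
  show "continuous_on UNIV (gaussian_density A)"
    unfolding gaussian_density_def divide_inverse by (intro continuous_intros)
qed

lemma gaussian_density_pos: "pos_def A \<Longrightarrow> 0 < gaussian_density A x"
  by (simp add: gaussian_density_def det_pos_def)

lemma sets_gaussian [simp, measurable_cong]: "sets (gaussian A) = sets borel"
  by (simp add: gaussian_def)

lemma space_gaussian [simp]: "space (gaussian A) = UNIV"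
  by (simp add: gaussian_def)

lemma matrix_inv_mat_1: "matrix_inv (mat 1 :: real ^ 'k ^ 'k) = mat 1"
  using matrix_inv_mult(1)[OF pos_def_invertible[OF pos_def_mat_1]] by simp

lemma std_gaussian_density:
  "gaussian_density (mat 1) (x :: real ^ 'k) = exp (- (x \<bullet> x) / 2) / sqrt (2 * pi) ^ CARD('k)"
  unfolding gaussian_density_def matrix_inv_mat_1 det_I real_sqrt_power mult_1_right by simp

lemma std_gaussian_density_prod:
  fixes x :: "real ^ 'k"
  shows "gaussian_density (mat 1) x = (\<Prod>b\<in>Basis. std_normal_density (x \<bullet> b))"
proof -
  have "(\<Prod>b\<in>Basis. std_normal_density (x \<bullet> b)) =
    (1 / sqrt (2 * pi)) ^ CARD('k) * exp (\<Sum>b\<in>Basis. - (x \<bullet> b)\<^sup>2 / 2)"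
    unfolding std_normal_density_def prod.distrib by (simp add: exp_sum)
  also have "(\<Sum>b\<in>Basis. - (x \<bullet> b)\<^sup>2 / 2) = - (x \<bullet> x) / 2"
    by (simp add: euclidean_inner[of x x] sum_negf sum_divide_distrib power2_eq_square)
  finally show ?thesis
    by (simp add: std_gaussian_density power_divide)
qed

lemma prob_space_std_gaussian: "prob_space (gaussian (mat 1 :: real ^ 'k ^ 'k))"
proof
  have "emeasure (gaussian (mat 1 :: real ^ 'k ^ 'k)) UNIV =
    (\<integral>\<^sup>+x. (\<Prod>b\<in>Basis. ennreal (std_normal_density ((x :: real ^ 'k) \<bullet> b))) \<partial>lborel)"
    by (simp add: gaussian_def emeasure_density std_gaussian_density_prod prod_ennreal)
  also have "\<dots> = (\<Prod>b\<in>(Basis :: (real ^ 'k) set). \<integral>\<^sup>+x. ennreal (std_normal_density x) \<partial>lborel)"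
    by (rule nn_integral_lborel_prod) auto
  also have "(\<integral>\<^sup>+x. ennreal (std_normal_density x) \<partial>lborel) = 1"
    by (subst nn_integral_eq_integral) auto
  finally show "emeasure (gaussian (mat 1 :: real ^ 'k ^ 'k)) (space (gaussian (mat 1))) = 1"
    by simp
qed

lemma pos_def_factor_invertible:
  fixes L S :: "real ^ 'k ^ 'k"
  assumes "pos_def S" "L ** transpose L = S"
  shows "invertible L"
  using pos_def_invertible[OF assms(1)] assms(2)
  by (metis det_mul invertible_det_nz mult_eq_0_iff)

text \<open>
  Every factorization \<open>L L\<^sup>T = S\<close> represents the Gaussian measure as an image of the standard one. The
  freedom in \<open>L\<close> is essential: the symmetric root gives the total mass and the moments, triangular
  factors give the marginals.
\<close>

theorem gaussian_linear_image:
  fixes L S :: "real ^ 'k ^ 'k"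
  assumes S: "pos_def S" and L: "L ** transpose L = S"
  shows "gaussian S = distr (gaussian (mat 1)) borel ((*v) L)"
proof -
  note inv = matrix_inv_cancel[OF pos_def_factor_invertible[OF S L]]
    and invT = matrix_inv_cancel[OF transpose_invertible[OF pos_def_factor_invertible[OF S L]]]
    and invS = matrix_inv_cancel[OF pos_def_invertible[OF S]]
  have [measurable]: "(*v) L \<in> borel_measurable borel"
    by (rule borel_measurable_linear) simp
  have det: "det L \<noteq> 0"
    using pos_def_factor_invertible[OF S L] by (simp add: invertible_det_nz)
  have detS: "det S = (det L)\<^sup>2" by (simp add: power2_eq_square det_mul flip: L)
  have form: "(L *v x) \<bullet> (matrix_inv S *v (L *v x)) = x \<bullet> x" for x
  proof -
    have "S *v (matrix_inv (transpose L) *v x) = L *v x"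
      by (simp add: L[symmetric] matrix_vector_mul_assoc[symmetric] invT del: transpose_matrix_vector)
    then have "matrix_inv S *v (L *v x) = matrix_inv (transpose L) *v x" by (metis invS(2))
    then show ?thesis by (simp add: inner_matrix_vector_left invT del: transpose_matrix_vector)
  qed
  have dens: "\<bar>det L\<bar> * gaussian_density S (L *v x) = gaussian_density (mat 1) x" for x
    using det
    by (simp add: gaussian_density_def form detS matrix_inv_mat_1 real_sqrt_mult real_sqrt_abs)
  have lb: "lborel = density (distr lborel borel ((*v) L)) (\<lambda>_. ennreal \<bar>det L\<bar>)"
    using lborel_linear_image[of "(*v) L"] det by simp
  have "gaussian S = density (density (distr lborel borel ((*v) L)) (\<lambda>_. ennreal \<bar>det L\<bar>))
    (\<lambda>x. ennreal (gaussian_density S x))"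
    unfolding gaussian_def by (subst lb) simp
  also have "\<dots> = density (distr lborel borel ((*v) L))
    (\<lambda>x. ennreal (\<bar>det L\<bar> * gaussian_density S x))"
    by (subst density_density_eq) (auto simp: ennreal_mult')
  also have "\<dots> = distr (density lborel (\<lambda>x. ennreal (\<bar>det L\<bar> * gaussian_density S (L *v x)))) borel ((*v) L)"
    by (subst density_distr) auto
  finally show ?thesis by (simp add: dens gaussian_def)
qed

lemma prob_space_gaussian:
  assumes "pos_def A"
  shows "prob_space (gaussian A)"
proof -
  have "pd_sqrt A ** transpose (pd_sqrt A) = A"
    using pd_sqrt[OF assms] by (simp add: pos_def_sym)
  moreover have "(*v) (pd_sqrt A) \<in> borel_measurable borel"
    by (rule borel_measurable_linear) simp
  ultimately show ?thesis
    by (simp add: gaussian_linear_image[OF assms] prob_space.prob_space_distr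
        prob_space_std_gaussian)
qed

text \<open>
  By the elementary bound \<open>t * exp (- t / 2) \<le> 4 * exp (- t / 4)\<close> with \<open>t = (norm x)\<^sup>2\<close>, the second moment of
  the standard Gaussian is dominated by the total mass of the Gaussian with covariance \<open>2 I\<close>. A
  linear map changes the norm by a bounded factor.
\<close>

lemma integrable_gaussian_norm_square:
  assumes A: "pos_def A"
  shows "integrable (gaussian A) (\<lambda>x. (norm x)\<^sup>2)"
proof -
  let ?I = "mat 1 :: real ^ 'a ^ 'a"
  have pd2: "pos_def (2 *\<^sub>R ?I)" by (intro pos_def_scaleR pos_def_mat_1) simp
  have inv2: "matrix_inv (2 *\<^sub>R ?I) *v x = (1 / 2) *\<^sub>R x" for x
  proof -
    have "(2 *\<^sub>R ?I) *v ((1 / 2) *\<^sub>R x) = x" by (simp add: scaleR_matrix_vector_assoc[symmetric])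
    then show ?thesis by (metis matrix_inv_cancel(2)[OF pos_def_invertible[OF pd2]])
  qed
  \<comment> \<open>The factor 4 of the elementary bound, times the quotient of the two normalizing constants.\<close>
  define c where "c = 4 * sqrt ((2 * pi) ^ CARD('a) * det (2 *\<^sub>R ?I)) / sqrt ((2 * pi) ^ CARD('a))"
  have c: "0 \<le> c" using det_pos_def[OF pd2] by (simp add: c_def)
  have bound: "(norm x)\<^sup>2 * gaussian_density ?I x \<le> c * gaussian_density (2 *\<^sub>R ?I) x" for x
  proof -
    let ?t = "(norm x)\<^sup>2"
    have "?t / 4 \<le> exp (?t / 4)" using exp_ge_add_one_self[of "?t / 4"] by linarith
    then have "?t * exp (- ?t / 2) \<le> 4 * exp (?t / 4) * exp (- ?t / 2)"
      by (intro mult_right_mono) auto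
    also have "\<dots> = 4 * exp (- ?t / 4)" by (simp add: mult_exp_exp field_simps)
    finally show ?thesis
      using det_pos_def[OF pd2]
      by (simp add: gaussian_density_def inv2 matrix_inv_mat_1 c_def power2_norm_eq_inner
          field_simps)
  qed
  have std: "integrable (gaussian ?I) (\<lambda>x. (norm x)\<^sup>2)"
  proof (rule integrableI_bounded)
    have "(\<integral>\<^sup>+x. ennreal (norm ((norm x)\<^sup>2)) \<partial>gaussian ?I) =
      (\<integral>\<^sup>+x. ennreal ((norm x)\<^sup>2 * gaussian_density ?I x) \<partial>lborel)"
      unfolding gaussian_def
      by (subst nn_integral_density) (auto simp: ennreal_mult'' mult.commute)
    also have "\<dots> \<le> (\<integral>\<^sup>+x. ennreal (c * gaussian_density (2 *\<^sub>R ?I) x) \<partial>lborel)"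
      by (intro nn_integral_mono ennreal_leI bound)
    also have "\<dots> = ennreal c * emeasure (gaussian (2 *\<^sub>R ?I)) (space (gaussian (2 *\<^sub>R ?I)))"
      using c by (simp add: gaussian_def emeasure_density ennreal_mult' nn_integral_cmult)
    also have "\<dots> < \<infinity>"
      unfolding prob_space.emeasure_space_1[OF prob_space_gaussian[OF pd2]] by simp
    finally show "(\<integral>\<^sup>+x. ennreal (norm ((norm x)\<^sup>2)) \<partial>gaussian ?I) < \<infinity>" .
  qed simp
  define R where "R = pd_sqrt A"
  have R: "R ** transpose R = A" using pd_sqrt[OF A] by (simp add: R_def pos_def_sym)
  have [measurable]: "(*v) R \<in> borel_measurable borel" by (rule borel_measurable_linear) simp
  have "integrable (gaussian ?I) (\<lambda>x. (norm (R *v x))\<^sup>2)"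
  proof (rule Bochner_Integration.integrable_bound)
    show "integrable (gaussian ?I) (\<lambda>x. (onorm ((*v) R))\<^sup>2 * (norm x)\<^sup>2)" using std by simp
    have "norm (R *v x) \<le> onorm ((*v) R) * norm x" for x by (rule onorm) simp
    then have "(norm (R *v x))\<^sup>2 \<le> (onorm ((*v) R) * norm x)\<^sup>2" for x by (intro power_mono) auto
    then show "AE x in gaussian ?I. norm ((norm (R *v x))\<^sup>2) \<le> norm ((onorm ((*v) R))\<^sup>2 * (norm x)\<^sup>2)"
      by (simp add: power_mult_distrib)
  qed simp
  then show ?thesis
    unfolding gaussian_linear_image[OF A R] by (subst integrable_distr_eq) auto
qed

section \<open>Gaussian measures on pairs and their marginals\<close>

lemma linear_split_vec: "linear split_vec"
  by (simp add: linear_iff split_vec_def vec_eq_iff)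

lemma linear_join_vec: "linear join_vec"
  by (auto simp: linear_iff join_vec_def vec_eq_iff split: sum.split)

lemma borel_measurable_split_vec [measurable]: "split_vec \<in> borel_measurable borel"
  by (rule borel_measurable_linear[OF linear_split_vec])

lemma borel_measurable_join_vec [measurable]: "join_vec \<in> borel_measurable borel"
  by (rule borel_measurable_linear[OF linear_join_vec])

lemma borel_measurable_pair_projections [measurable]:
  "(fst :: 'a::euclidean_space \<times> 'b::euclidean_space \<Rightarrow> 'a) \<in> borel_measurable borel"
  "(snd :: 'a::euclidean_space \<times> 'b::euclidean_space \<Rightarrow> 'b) \<in> borel_measurable borel"
  by (rule borel_measurable_linear[OF linear_fst], rule borel_measurable_linear[OF linear_snd])

lemma prod_Basis_vec: "(\<Prod>b\<in>(Basis :: (real ^ 'k) set). f b) = (\<Prod>i\<in>UNIV. f (axis i 1))"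
proof -
  have Basis: "Basis = (\<lambda>i. axis i (1::real) :: real ^ 'k) ` UNIV" by (auto simp: Basis_vec_def)
  have inj: "inj (\<lambda>i. axis i (1::real) :: real ^ 'k)" by (auto simp: inj_def axis_eq_axis)
  show ?thesis unfolding Basis prod.reindex[OF inj] by simp
qed

lemma prod_UNIV_sum: "(\<Prod>i\<in>(UNIV :: ('a::finite + 'b::finite) set). f i) =
  (\<Prod>a\<in>UNIV. f (Inl a)) * (\<Prod>b\<in>UNIV. f (Inr b))"
  by (subst UNIV_Plus_UNIV[symmetric], subst prod.Plus) auto

lemma distr_lborel_split_vec:
  "distr lborel borel split_vec = (lborel :: ((real ^ 'n) \<times> (real ^ 'n)) measure)"
proof (rule lborel_eqI[symmetric])
  fix l u :: "(real ^ 'n) \<times> (real ^ 'n)"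
  assume le: "\<And>b. b \<in> Basis \<Longrightarrow> l \<bullet> b \<le> u \<bullet> b"
  have le': "fst l $ i \<le> fst u $ i" "snd l $ i \<le> snd u $ i" for i
    using le[of "(axis i 1, 0)"] le[of "(0, axis i 1)"]
    by (auto simp: Basis_prod_def Basis_vec_def inner_prod_def inner_axis)
  have pre: "split_vec -` box l u = box (join_vec l) (join_vec u)"
    by (auto simp: set_eq_iff box_prod mem_box_cart split_vec_def join_vec_def split_sum_all)
  have "emeasure (distr lborel borel split_vec) (box l u) =
      emeasure lborel (box (join_vec l) (join_vec u))"
    by (subst emeasure_distr) (auto simp: pre)
  also have "\<dots> = ennreal (\<Prod>b\<in>Basis. (join_vec u - join_vec l) \<bullet> b)"
    using le' by (subst emeasure_lborel_box)
      (auto simp: Basis_vec_def inner_axis join_vec_def split: sum.split)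
  also have "(\<Prod>b\<in>Basis. (join_vec u - join_vec l) \<bullet> b) = (\<Prod>b\<in>Basis. (u - l) \<bullet> b)"
  proof -
    have "(\<Prod>b\<in>Basis. (u - l) \<bullet> b) =
      (\<Prod>b\<in>Basis. (fst u - fst l) \<bullet> b) * (\<Prod>b\<in>Basis. (snd u - snd l) \<bullet> b)"
      unfolding Basis_prod_def
      by (subst prod.union_disjoint) (auto simp: prod.reindex inj_on_def inner_prod_def)
    then show ?thesis
      by (simp add: prod_Basis_vec prod_UNIV_sum inner_axis join_vec_def)
  qed
  finally show "emeasure (distr lborel borel split_vec) (box l u) =
      ennreal (\<Prod>b\<in>Basis. (u - l) \<bullet> b)" .
qed simp

lemma gaussian_pair_density:
  "gaussian_pair S = density lborel (\<lambda>p. ennreal (gaussian_density S (join_vec p)))"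
  unfolding gaussian_pair_def gaussian_def
  by (subst distr_lborel_split_vec[symmetric], subst density_distr) auto

lemma sets_gaussian_pair [simp, measurable_cong]: "sets (gaussian_pair S) = sets borel"
  by (simp add: gaussian_pair_def)

lemma prob_space_gaussian_pair: "pos_def S \<Longrightarrow> prob_space (gaussian_pair S)"
  unfolding gaussian_pair_def by (intro prob_space.prob_space_distr prob_space_gaussian) auto

lemma std_gaussian_pair:
  "gaussian_pair (mat 1 :: real ^ ('n + 'n) ^ ('n + 'n)) =
    gaussian (mat 1 :: real ^ 'n ^ 'n) \<Otimes>\<^sub>M gaussian (mat 1 :: real ^ 'n ^ 'n)"
proof -
  have dens: "gaussian_density (mat 1) (join_vec (x, y)) =
      gaussian_density (mat 1) x * gaussian_density (mat 1) (y :: real ^ 'n)" for x y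
    by (simp add: std_gaussian_density inner_prod_def power_add diff_divide_distrib flip: exp_add)
  have "sigma_finite_measure (gaussian (mat 1 :: real ^ 'n ^ 'n))"
    using prob_space_std_gaussian prob_space_imp_sigma_finite by blast
  then show ?thesis
    unfolding gaussian_pair_density gaussian_def[where 'k = 'n]
    by (subst pair_measure_density)
       (auto simp: gaussian_def lborel_prod dens ennreal_mult gaussian_density_pos pos_def_mat_1
          less_imp_le split_beta' intro!: density_cong lborel.sigma_finite_measure_axioms)
qed

lemma std_gaussian_pair_marginals:
  "distr (gaussian_pair (mat 1)) borel fst = gaussian (mat 1 :: real ^ 'n ^ 'n)"
  "distr (gaussian_pair (mat 1)) borel snd = gaussian (mat 1 :: real ^ 'n ^ 'n)"
proof -
  let ?g = "gaussian (mat 1 :: real ^ 'n ^ 'n)"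
  interpret g: prob_space ?g by (rule prob_space_std_gaussian)
  interpret gg: pair_sigma_finite ?g ?g ..
  have "distr (?g \<Otimes>\<^sub>M ?g) borel fst = distr (?g \<Otimes>\<^sub>M ?g) ?g fst" by (intro distr_cong) auto
  then show fst: "distr (gaussian_pair (mat 1)) borel fst = ?g"
    by (simp add: std_gaussian_pair g.distr_pair_fst)
  have "distr (?g \<Otimes>\<^sub>M ?g) borel snd = distr (distr (?g \<Otimes>\<^sub>M ?g) (?g \<Otimes>\<^sub>M ?g) (\<lambda>(x, y). (y, x))) borel snd"
    by (simp flip: gg.distr_pair_swap)
  also have "\<dots> = distr (?g \<Otimes>\<^sub>M ?g) borel fst"
    by (subst distr_distr) (auto simp: comp_def split_beta')
  finally show "distr (gaussian_pair (mat 1)) borel snd = ?g"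
    using fst by (simp add: std_gaussian_pair)
qed

text \<open>
  A projection of a triangular linear image is a linear image of the projection, so both marginals
  reduce to those of the standard Gaussian, which is a product measure.
\<close>

theorem gaussian_pair_marginals:
  fixes A B C :: "real ^ 'n ^ 'n"
  assumes S: "pos_def (block_matrix A C (transpose C) B)"
  shows "distr (gaussian_pair (block_matrix A C (transpose C) B)) borel fst = gaussian A"
    and "distr (gaussian_pair (block_matrix A C (transpose C) B)) borel snd = gaussian B"
proof -
  let ?S = "block_matrix A C (transpose C) B"
  let ?g = "gaussian (mat 1 :: real ^ ('n + 'n) ^ ('n + 'n))"
  have pd: "pos_def A" "pos_def B"
    using S pos_def_block_swap[OF S] pos_def_block_iff[of A C B]
      pos_def_block_iff[of B "transpose C" A] by auto
  have meas [measurable]: "(*v) M \<in> borel_measurable borel" for M :: "real ^ 'k ^ 'k"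
    by (rule borel_measurable_linear) simp
  have push: "distr (gaussian_pair ?S) borel p = gaussian D"
    if L: "L ** transpose L = ?S" and R: "R ** transpose R = D" "pos_def D"
      and [measurable]: "p \<in> borel_measurable borel"
      and p: "\<And>z. p (split_vec (L *v z)) = R *v p (split_vec z)"
      and std: "distr (gaussian_pair (mat 1)) borel p = gaussian (mat 1)"
    for L R D and p :: "(real ^ 'n) \<times> (real ^ 'n) \<Rightarrow> real ^ 'n"
  proof -
    have "distr (gaussian_pair ?S) borel p = distr ?g borel (\<lambda>z. p (split_vec (L *v z)))"
      unfolding gaussian_pair_def gaussian_linear_image[OF S L]
      by (simp add: distr_distr comp_def)
    also have "\<dots> = distr (distr (gaussian_pair (mat 1)) borel p) borel ((*v) R)"
      unfolding gaussian_pair_def by (simp add: p distr_distr comp_def)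
    finally show ?thesis by (simp add: std gaussian_linear_image[OF R(2,1)])
  qed
  obtain R X T where *: "R ** transpose R = A"
    "block_matrix R 0 X T ** transpose (block_matrix R 0 X T) = ?S"
    using block_factorization[OF S] .
  have "fst (split_vec (block_matrix R 0 X T *v z)) = R *v fst (split_vec z)" for z
    by (cases z rule: join_vec_cases) simp
  then show "distr (gaussian_pair ?S) borel fst = gaussian A"
    by (intro push[OF *(2,1) pd(1)] std_gaussian_pair_marginals) auto
  obtain R X T where *: "R ** transpose R = B"
    "block_matrix T X 0 R ** transpose (block_matrix T X 0 R) = ?S"
    using block_factorization_upper[OF S] .
  have "snd (split_vec (block_matrix T X 0 R *v z)) = R *v snd (split_vec z)" for z
    by (cases z rule: join_vec_cases) simp
  then show "distr (gaussian_pair ?S) borel snd = gaussian B"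
    by (intro push[OF *(2,1) pd(2)] std_gaussian_pair_marginals) auto
qed

section \<open>Relative entropy\<close>

lemma borel_measurable_entropy_density [measurable]:
  "entropy_density b M N \<in> borel_measurable M"
  unfolding entropy_density_def by measurable

text \<open>
  The chain rule for densities. The references \<open>\<rho>\<close> and \<open>\<tau>\<close> have the same null sets, and the log-densities
  of \<open>\<pi>\<close> with respect to them differ by the integrable function \<open>h\<close>, so the two entropies
  are infinite simultaneously.
\<close>

lemma KL_change_of_reference:
  assumes \<rho>: "prob_space \<rho>" and \<pi>: "prob_space \<pi>" and sets: "sets \<pi> = sets \<rho>"
    and h [measurable]: "h \<in> borel_measurable \<rho>" and int: "integrable \<pi> h"
    and \<tau>: "\<tau> = density \<rho> (\<lambda>x. ennreal (exp (h x)))" "prob_space \<tau>"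
  shows "KL \<pi> \<rho> = KL \<pi> \<tau> + ereal (\<integral>x. h x \<partial>\<pi>)"
proof -
  interpret \<rho>: prob_space \<rho> by fact
  interpret \<tau>: prob_space \<tau> by fact
  interpret \<pi>: prob_space \<pi> by fact
  have sets\<tau>: "sets \<pi> = sets \<tau>" using sets by (simp add: \<tau>(1))
  have "null_sets \<tau> = null_sets \<rho>"
  proof -
    have "(AE x in \<rho>. x \<in> N \<longrightarrow> ennreal (exp (h x)) = 0) \<longleftrightarrow> (AE x in \<rho>. x \<notin> N)" for N
      by (intro AE_cong) auto
    then show ?thesis
      unfolding \<tau>(1) by (auto simp: null_sets_density_iff AE_iff_null_sets[symmetric] AE_not_in)
  qed
  then have ac_iff: "absolutely_continuous \<rho> \<pi> \<longleftrightarrow> absolutely_continuous \<tau> \<pi>"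
    by (simp add: absolutely_continuous_def)
  show ?thesis
  proof (cases "absolutely_continuous \<rho> \<pi>")
    case False
    then show ?thesis using ac_iff by (simp add: KL_def)
  next
    case True
    then have ac: "absolutely_continuous \<tau> \<pi>" using ac_iff by simp
    define D where "D = RN_deriv \<tau> \<pi>"
    have D_meas [measurable]: "D \<in> borel_measurable \<rho>"
      using borel_measurable_RN_deriv[of \<tau> \<pi>] by (simp add: D_def \<tau>(1))
    have D: "density \<tau> D = \<pi>"
      unfolding D_def by (rule \<tau>.density_RN_deriv[OF ac sets\<tau>])
    then have "density \<rho> (\<lambda>x. ennreal (exp (h x)) * D x) = \<pi>"
      unfolding \<tau>(1) by (subst (asm) density_density_eq) auto
    then have "AE x in \<rho>. ennreal (exp (h x)) * D x = RN_deriv \<rho> \<pi> x"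
      by (intro \<rho>.RN_deriv_unique) auto
    then have 1: "AE x in \<pi>. ennreal (exp (h x)) * D x = RN_deriv \<rho> \<pi> x"
      by (rule absolutely_continuous_AE[OF sets True])
    have 2: "AE x in \<pi>. 0 < D x"
      using D_meas by (subst D[symmetric]) (simp add: AE_density \<tau>(1))
    have "AE x in \<tau>. D x \<noteq> \<infinity>"
      unfolding D_def by (rule \<tau>.RN_deriv_finite[OF _ ac sets\<tau>]) (rule \<pi>.sigma_finite_measure_axioms)
    then have 3: "AE x in \<pi>. D x \<noteq> \<infinity>"
      by (rule absolutely_continuous_AE[OF sets\<tau> ac])
    from 1 2 3 have ae: "AE x in \<pi>. entropy_density (exp 1) \<rho> \<pi> x =
      entropy_density (exp 1) \<tau> \<pi> x + h x"
    proof eventually_elim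
      case (elim x)
      then have "0 < enn2real (D x)" by (simp add: enn2real_positive_iff less_top)
      then show ?case
        by (simp add: entropy_density_def elim(1)[symmetric] D_def[symmetric] enn2real_mult
            log_def ln_mult)
    qed
    have [measurable]: "entropy_density (exp 1) \<rho> \<pi> \<in> borel_measurable \<pi>"
      "h \<in> borel_measurable \<pi>"
      unfolding measurable_cong_sets[OF sets refl] by auto
    have [measurable]: "entropy_density (exp 1) \<tau> \<pi> \<in> borel_measurable \<pi>"
      unfolding measurable_cong_sets[OF sets\<tau> refl] by auto
    have "integrable \<pi> (entropy_density (exp 1) \<rho> \<pi>) \<longleftrightarrow>
        integrable \<pi> (\<lambda>x. entropy_density (exp 1) \<tau> \<pi> x + h x)"
      by (rule integrable_cong_AE[OF _ _ ae]) auto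
    also have "\<dots> \<longleftrightarrow> integrable \<pi> (entropy_density (exp 1) \<tau> \<pi>)"
      using int Bochner_Integration.integrable_diff[OF _ int, of "\<lambda>x. entropy_density (exp 1) \<tau> \<pi> x + h x"]
      by auto
    finally have int_iff: "integrable \<pi> (entropy_density (exp 1) \<rho> \<pi>) \<longleftrightarrow>
      integrable \<pi> (entropy_density (exp 1) \<tau> \<pi>)" .
    have "KL_divergence (exp 1) \<rho> \<pi> = KL_divergence (exp 1) \<tau> \<pi> + (\<integral>x. h x \<partial>\<pi>)"
      if i: "integrable \<pi> (entropy_density (exp 1) \<tau> \<pi>)"
    proof -
      have "KL_divergence (exp 1) \<rho> \<pi> = (\<integral>x. entropy_density (exp 1) \<tau> \<pi> x + h x \<partial>\<pi>)"
        unfolding KL_divergence_def by (rule integral_cong_AE[OF _ _ ae]) auto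
      then show ?thesis using i int by (simp add: KL_divergence_def)
    qed
    then show ?thesis using True ac int_iff by (simp add: KL_def)
  qed
qed

lemma KL_self: "prob_space \<tau> \<Longrightarrow> KL \<tau> \<tau> = 0"
proof -
  assume "prob_space \<tau>"
  then interpret prob_space \<tau> .
  have "AE x in \<tau>. 1 = RN_deriv \<tau> \<tau> x"
    by (rule RN_deriv_unique) (auto simp: density_1)
  then have "AE x in \<tau>. entropy_density (exp 1) \<tau> \<tau> x = 0"
    by eventually_elim (simp add: entropy_density_def)
  then have "integrable \<tau> (entropy_density (exp 1) \<tau> \<tau>) \<longleftrightarrow> integrable \<tau> (\<lambda>_. 0 :: real)"
    by (intro integrable_cong_AE) auto
  then show ?thesis
    by (simp add: KL_def absolutely_continuous_def KL_same_eq_0 zero_ereal_def)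
qed

text \<open>
  When the relative entropy is infinite both claims are trivial; otherwise they are the strict
  positivity of the divergence between different probability measures.
\<close>

lemma KL_nonneg_and_eq_0_iff:
  assumes \<tau>: "prob_space \<tau>" and \<pi>: "prob_space \<pi>" and sets: "sets \<pi> = sets \<tau>"
  shows Gibbs_inequality: "0 \<le> KL \<pi> \<tau>" and KL_eq_0_iff: "KL \<pi> \<tau> = 0 \<longleftrightarrow> \<pi> = \<tau>"
proof -
  interpret \<tau>: prob_space \<tau> by fact
  interpret \<pi>: prob_space \<pi> by fact
  interpret information_space \<tau> "exp 1" by unfold_locales simp
  have *: "0 \<le> KL_divergence (exp 1) \<tau> \<pi>"
    if ac: "absolutely_continuous \<tau> \<pi>" and int: "integrable \<pi> (entropy_density (exp 1) \<tau> \<pi>)"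
  proof -
    obtain D where D: "D \<in> borel_measurable \<tau>"
      "AE x in \<tau>. RN_deriv \<tau> \<pi> x = ennreal (D x)" "\<And>x. 0 \<le> D x"
      using \<tau>.real_RN_deriv[OF \<pi>.finite_measure_axioms ac sets] by metis
    have \<pi>_eq: "\<pi> = density \<tau> D"
      using \<tau>.density_RN_deriv[OF ac sets] D by (metis density_cong borel_measurable_RN_deriv measurable_compose_rev measurable_ennreal)
    have "AE x in \<tau>. D x * entropy_density (exp 1) \<tau> \<pi> x = D x * log (exp 1) (D x)"
      using D(2) by eventually_elim (simp add: entropy_density_def D(3))
    moreover have "integrable \<tau> (\<lambda>x. D x * entropy_density (exp 1) \<tau> \<pi> x)"
      using int D(1,3) borel_measurable_entropy_density[of "exp 1" \<tau> \<pi>]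
      by (subst integrable_real_density[symmetric]) (auto simp flip: \<pi>_eq)
    ultimately have "integrable \<tau> (\<lambda>x. D x * log (exp 1) (D x))"
      using D(1) by (subst integrable_cong_AE[symmetric]) auto
    then show ?thesis
      using KL_nonneg[of D] D \<pi> by (simp flip: \<pi>_eq)
  qed
  then show "0 \<le> KL \<pi> \<tau>" by (simp add: KL_def)
  show "KL \<pi> \<tau> = 0 \<longleftrightarrow> \<pi> = \<tau>"
    using KL_eq_0_iff_eq_ac[OF \<pi> _ sets] KL_self[OF \<tau>] by (auto simp: KL_def zero_ereal_def split: if_splits)
qed

section \<open>Sufficient optimality conditions for entropic transport\<close>

text \<open>
  If the log-density \<open>h\<close> of a coupling \<open>\<tau>\<close> relative to the reference compensates the transport cost up
  to a sum of functions of one variable, then \<open>\<tau>\<close> is optimal: such a sum has the same integral \<open>K\<close> under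
  all couplings, so by the chain rule the objective at \<open>\<pi>\<close> is \<open>K + 2 \<epsilon> KL(\<pi>|\<tau>)\<close>, and Gibbs' inequality
  identifies the unique minimizer.
\<close>

theorem eot_solutions_of_separated_potentials:
  fixes \<mu> \<nu> :: "(real ^ 'n) measure"
  assumes "\<epsilon> > 0" and \<rho>: "prob_space \<rho>" "sets \<rho> = sets borel"
    and h [measurable]: "h \<in> borel_measurable borel"
    and \<tau>: "\<tau> = density \<rho> (\<lambda>p. ennreal (exp (h p)))" "\<tau> \<in> couplings \<mu> \<nu>"
    and split: "\<And>x y. (norm (x - y))\<^sup>2 + 2 * \<epsilon> * h (x, y) = a x + b y"
    and a: "integrable \<mu> a" and b: "integrable \<nu> b"
    and sq: "integrable \<mu> (\<lambda>x. (norm x)\<^sup>2)" "integrable \<nu> (\<lambda>y. (norm y)\<^sup>2)"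
  shows "eot_solutions \<epsilon> \<rho> \<mu> \<nu> = {\<tau>}"
proof -
  have sets\<mu>: "sets \<mu> = sets borel" "sets \<nu> = sets borel"
    using \<tau>(2) by (auto simp: couplings_def)
  define K where "K = (\<integral>x. a x \<partial>\<mu>) + (\<integral>y. b y \<partial>\<nu>)"
  have prob\<tau>: "prob_space \<tau>" using \<tau>(2) by (simp add: couplings_def)
  have cost: "eot_cost \<epsilon> \<rho> \<pi> = ereal K + ereal (2 * \<epsilon>) * KL \<pi> \<tau>" if "\<pi> \<in> couplings \<mu> \<nu>" for \<pi>
  proof -
    have sets [measurable_cong]: "sets \<pi> = sets borel" and \<pi>: "prob_space \<pi>"
      and \<mu>: "\<mu> = distr \<pi> borel fst" and \<nu>: "\<nu> = distr \<pi> borel snd"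
      using that by (auto simp: couplings_def)
    interpret \<pi>: prob_space \<pi> by fact
    have fst_int: "integrable \<pi> (\<lambda>p. g (fst p)) \<and> (\<integral>p. g (fst p) \<partial>\<pi>) = (\<integral>x. g x \<partial>\<mu>)"
      if "integrable \<mu> g" for g :: "_ \<Rightarrow> real"
    proof -
      have [measurable]: "g \<in> borel_measurable borel"
        using borel_measurable_integrable[OF that] by (simp add: measurable_cong_sets[OF sets\<mu>(1)])
      show ?thesis using that unfolding \<mu> by (simp add: integrable_distr_eq integral_distr)
    qed
    have snd_int: "integrable \<pi> (\<lambda>p. g (snd p)) \<and> (\<integral>p. g (snd p) \<partial>\<pi>) = (\<integral>x. g x \<partial>\<nu>)"
      if "integrable \<nu> g" for g :: "_ \<Rightarrow> real"
    proof -
      have [measurable]: "g \<in> borel_measurable borel"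
        using borel_measurable_integrable[OF that] by (simp add: measurable_cong_sets[OF sets\<mu>(2)])
      show ?thesis using that unfolding \<nu> by (simp add: integrable_distr_eq integral_distr)
    qed
    note ints = fst_int[OF a] snd_int[OF b] fst_int[OF sq(1)] snd_int[OF sq(2)]
    have c_int: "integrable \<pi> (\<lambda>p. (norm (fst p - snd p))\<^sup>2)"
    proof (rule Bochner_Integration.integrable_bound)
      show "integrable \<pi> (\<lambda>p. 2 * (norm (fst p))\<^sup>2 + 2 * (norm (snd p))\<^sup>2)" using ints by auto
      have "(norm (x - y))\<^sup>2 \<le> 2 * (norm x)\<^sup>2 + 2 * (norm y)\<^sup>2" for x y :: "real ^ 'n"
      proof -
        have "(norm (x - y))\<^sup>2 \<le> (norm x + norm y)\<^sup>2" by (intro power_mono norm_triangle_ineq4) simp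
        also have "\<dots> \<le> 2 * (norm x)\<^sup>2 + 2 * (norm y)\<^sup>2"
          using zero_le_power2[of "norm x - norm y"] by (simp add: power2_eq_square algebra_simps)
        finally show ?thesis .
      qed
      then show "AE p in \<pi>. norm ((norm (fst p - snd p))\<^sup>2) \<le>
        norm (2 * (norm (fst p))\<^sup>2 + 2 * (norm (snd p))\<^sup>2)" by simp
    qed measurable
    have split': "(norm (fst p - snd p))\<^sup>2 + 2 * \<epsilon> * h p = a (fst p) + b (snd p)" for p
      using split[of "fst p" "snd p"] by simp
    have h_eq: "h p = (a (fst p) + b (snd p) - (norm (fst p - snd p))\<^sup>2) / (2 * \<epsilon>)" for p
      using split'[of p] \<open>\<epsilon> > 0\<close> by (simp add: field_simps)
    have h_int: "integrable \<pi> h"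
    proof -
      have "integrable \<pi> (\<lambda>p. (a (fst p) + b (snd p) - (norm (fst p - snd p))\<^sup>2) / (2 * \<epsilon>))"
        using ints c_int by auto
      then show ?thesis by (simp add: h_eq[symmetric])
    qed
    have "(\<integral>p. (norm (fst p - snd p))\<^sup>2 \<partial>\<pi>) + 2 * \<epsilon> * (\<integral>p. h p \<partial>\<pi>) =
      (\<integral>p. (norm (fst p - snd p))\<^sup>2 + 2 * \<epsilon> * h p \<partial>\<pi>)"
      using c_int h_int by simp
    also have "\<dots> = (\<integral>p. a (fst p) + b (snd p) \<partial>\<pi>)"
      by (simp only: split')
    also have "\<dots> = K" using ints by (simp add: K_def)
    finally have K: "(\<integral>p. (norm (fst p - snd p))\<^sup>2 \<partial>\<pi>) + 2 * \<epsilon> * (\<integral>p. h p \<partial>\<pi>) = K" .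
    have "(\<integral>\<^sup>+ (x, y). ennreal ((norm (x - y))\<^sup>2) \<partial>\<pi>) = ennreal (\<integral>p. (norm (fst p - snd p))\<^sup>2 \<partial>\<pi>)"
      using c_int by (subst nn_integral_eq_integral[symmetric]) (auto simp: split_beta')
    then have c: "enn2ereal (\<integral>\<^sup>+ (x, y). ennreal ((norm (x - y))\<^sup>2) \<partial>\<pi>) =
      ereal (\<integral>p. (norm (fst p - snd p))\<^sup>2 \<partial>\<pi>)"
      by simp
    have KL: "KL \<pi> \<rho> = KL \<pi> \<tau> + ereal (\<integral>p. h p \<partial>\<pi>)"
      using h by (intro KL_change_of_reference \<rho>(1) \<pi> h_int \<tau>(1) prob\<tau>)
        (auto simp: sets \<rho>(2) measurable_cong_sets[OF \<rho>(2)])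
    have "0 \<le> KL \<pi> \<tau>" by (rule Gibbs_inequality[OF prob\<tau> \<pi>]) (simp add: sets \<tau>(1) \<rho>(2))
    then show ?thesis
      unfolding eot_cost_def c KL K[symmetric] using \<open>\<epsilon> > 0\<close>
      by (cases "KL \<pi> \<tau>") (auto simp: algebra_simps)
  qed
  have Gibbs: "0 \<le> KL \<pi> \<tau>" "KL \<pi> \<tau> = 0 \<longleftrightarrow> \<pi> = \<tau>" if "\<pi> \<in> couplings \<mu> \<nu>" for \<pi>
    using that KL_nonneg_and_eq_0_iff[OF prob\<tau>, of \<pi>] by (auto simp: couplings_def \<tau>(1) \<rho>(2))
  have lower: "ereal K \<le> eot_cost \<epsilon> \<rho> \<pi>" if "\<pi> \<in> couplings \<mu> \<nu>" for \<pi>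
    using Gibbs(1)[OF that] \<open>\<epsilon> > 0\<close> unfolding cost[OF that]
    by (cases "KL \<pi> \<tau>") auto
  have cost\<tau>: "eot_cost \<epsilon> \<rho> \<tau> = ereal K" unfolding cost[OF \<tau>(2)] by (simp add: KL_self prob\<tau>)
  have inf: "(INF \<pi>\<in>couplings \<mu> \<nu>. eot_cost \<epsilon> \<rho> \<pi>) = ereal K"
    by (intro antisym INF_greatest lower INF_lower2[OF \<tau>(2)]) (simp add: cost\<tau>)
  have eq_iff: "eot_cost \<epsilon> \<rho> \<pi> = ereal K \<longleftrightarrow> \<pi> = \<tau>" if "\<pi> \<in> couplings \<mu> \<nu>" for \<pi>
    using Gibbs[OF that] \<open>\<epsilon> > 0\<close> unfolding cost[OF that]
    by (cases "KL \<pi> \<tau>") (auto simp: zero_ereal_def)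
  show ?thesis
    using eq_iff \<tau>(2) by (auto simp: eot_solutions_def inf)
qed

section \<open>The Gaussian solution\<close>

lemma integrable_gaussian_quadratic_form:
  assumes A: "pos_def A"
  shows "integrable (gaussian A) (\<lambda>x. x \<bullet> (P *v x))"
proof (rule Bochner_Integration.integrable_bound)
  show "integrable (gaussian A) (\<lambda>x. onorm ((*v) P) * (norm x)\<^sup>2)"
    using integrable_gaussian_norm_square[OF A] by simp
  have "\<bar>x \<bullet> (P *v x)\<bar> \<le> onorm ((*v) P) * (norm x)\<^sup>2" for x
  proof -
    have "\<bar>x \<bullet> (P *v x)\<bar> \<le> norm x * norm (P *v x)" by (rule Cauchy_Schwarz_ineq2)
    also have "\<dots> \<le> norm x * (onorm ((*v) P) * norm x)" by (intro mult_left_mono onorm) auto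
    finally show ?thesis by (simp add: power2_eq_square mult_ac)
  qed
  then show "AE x in gaussian A. norm (x \<bullet> (P *v x)) \<le> norm (onorm ((*v) P) * (norm x)\<^sup>2)"
    by (simp add: order_trans[OF _ abs_ge_self])
  have [measurable]: "(*v) P \<in> borel_measurable borel" by (rule borel_measurable_linear) simp
  show "(\<lambda>x. x \<bullet> (P *v x)) \<in> borel_measurable (gaussian A)" by measurable
qed

theorem theorem3p1:
  fixes A B M C :: "real ^ 'n ^ 'n"
    and \<Sigma> \<Gamma> :: "real ^ ('n + 'n) ^ ('n + 'n)"
    and \<epsilon> :: real
  defines "\<Gamma> \<equiv> matrix_inv \<Sigma>"
  defines "M \<equiv> mat 1 - \<epsilon> *\<^sub>R block12 \<Gamma>"
  defines "C \<equiv> (twisted_sqrt A (M ** B ** transpose M) (\<epsilon>\<^sup>2 / 4) - (\<epsilon> / 2) *\<^sub>R mat 1)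
                ** matrix_inv (transpose M)"
  assumes "pos_def A" and "pos_def B" and "pos_def \<Sigma>"
    and "\<epsilon> > 0" and "invertible M"
  shows "eot_solutions \<epsilon> (gaussian_pair \<Sigma>) (gaussian A) (gaussian B)
           = {gaussian_pair (block_matrix A C (transpose C) B)}"
proof -
  define S where "S = block_matrix A C (transpose C) B"
  \<comment> \<open>The log-density of the candidate relative to the reference has the mixed term
    \<open>x \<bullet> ((block12 \<Gamma> - block12 \<Lambda>) *v y)\<close>, which must equal \<open>(x \<bullet> y) / \<epsilon>\<close> to cancel the mixed term of the cost.\<close>
  define \<Lambda> where "\<Lambda> = matrix_inv S"
  have schur: "pos_def (schur A C B)" "M ** schur A C B = \<epsilon> *\<^sub>R (matrix_inv A ** C)"
    unfolding C_def by (rule coupling_schur_equation; fact)+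
  have S: "pos_def S"
    unfolding S_def pos_def_block_iff using \<open>pos_def A\<close> schur(1) by blast
  have \<Lambda>12: "block12 \<Lambda> = (- 1 / \<epsilon>) *\<^sub>R M"
    unfolding \<Lambda>_def S_def
  proof (rule block12_matrix_inv)
    show "pos_def (block_matrix A C (transpose C) B)" using S by (simp add: S_def)
    show "((- 1 / \<epsilon>) *\<^sub>R M) ** schur A C B = - (matrix_inv A ** C)"
      unfolding scalar_matrix_assoc[symmetric] schur(2) using \<open>\<epsilon> > 0\<close> by simp
  qed
  have sym: "transpose \<Lambda> = \<Lambda>" "transpose \<Gamma> = \<Gamma>"
    using S \<open>pos_def \<Sigma>\<close> by (simp_all add: \<Lambda>_def \<Gamma>_def pos_def_sym pos_def_matrix_inv)
  obtain P1 P2 where P: "\<And>x y. join_vec (x, y) \<bullet> (\<Lambda> *v join_vec (x, y)) =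
    x \<bullet> (P1 *v x) + y \<bullet> (P2 *v y) + 2 * (x \<bullet> (block12 \<Lambda> *v y))"
    using symmetric_quadratic_form_blocks[OF sym(1)] by blast
  obtain Q1 Q2 where Q: "\<And>x y. join_vec (x, y) \<bullet> (\<Gamma> *v join_vec (x, y)) =
    x \<bullet> (Q1 *v x) + y \<bullet> (Q2 *v y) + 2 * (x \<bullet> (block12 \<Gamma> *v y))"
    using symmetric_quadratic_form_blocks[OF sym(2)] by blast
  \<comment> \<open>The logarithm of the quotient of the two normalizing constants.\<close>
  define c where "c = ln (sqrt ((2 * pi) ^ CARD('n + 'n) * det \<Sigma>)) -
    ln (sqrt ((2 * pi) ^ CARD('n + 'n) * det S))"
  define h where "h p = c + (join_vec p \<bullet> (\<Gamma> *v join_vec p) - join_vec p \<bullet> (\<Lambda> *v join_vec p)) / 2"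
    for p :: "(real ^ 'n) \<times> (real ^ 'n)"
  have dens: "gaussian_density \<Sigma> (join_vec p) * exp (h p) = gaussian_density S (join_vec p)" for p
  proof -
    define s t where "s = sqrt ((2 * pi) ^ CARD('n + 'n) * det \<Sigma>)"
      and "t = sqrt ((2 * pi) ^ CARD('n + 'n) * det S)"
    have "0 < s" "0 < t"
      using det_pos_def[OF S] det_pos_def[OF \<open>pos_def \<Sigma>\<close>] by (simp_all add: s_def t_def)
    define q r where "q = join_vec p \<bullet> (\<Gamma> *v join_vec p)" and "r = join_vec p \<bullet> (\<Lambda> *v join_vec p)"
    have "exp (h p) = exp (ln s) / exp (ln t) * exp (q / 2 - r / 2)"
      by (simp only: h_def c_def q_def r_def s_def t_def exp_add exp_diff diff_divide_distrib)
    then have "exp (- q / 2) / s * exp (h p) = (exp (- q / 2) * exp (q / 2 - r / 2)) / t"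
      using \<open>0 < s\<close> \<open>0 < t\<close> by simp
    also have "exp (- q / 2) * exp (q / 2 - r / 2) = exp (- r / 2)"
      by (simp flip: exp_add)
    finally show ?thesis
      by (simp only: gaussian_density_def \<Gamma>_def \<Lambda>_def q_def r_def s_def t_def)
  qed
  have [measurable]: "(*v) G \<in> borel_measurable borel" for G :: "real ^ ('n + 'n) ^ ('n + 'n)"
    by (rule borel_measurable_linear) simp
  have h_meas [measurable]: "h \<in> borel_measurable borel" unfolding h_def[abs_def] by measurable
  have density: "gaussian_pair S = density (gaussian_pair \<Sigma>) (\<lambda>p. ennreal (exp (h p)))"
    unfolding gaussian_pair_density
    by (subst density_density_eq)
       (auto simp: dens gaussian_density_pos \<open>pos_def \<Sigma>\<close> less_imp_le simp flip: ennreal_mult)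
  define a where "a x = (norm x)\<^sup>2 + 2 * \<epsilon> * c + \<epsilon> * (x \<bullet> (Q1 *v x) - x \<bullet> (P1 *v x))" for x
  define b where "b y = (norm y)\<^sup>2 + \<epsilon> * (y \<bullet> (Q2 *v y) - y \<bullet> (P2 *v y))" for y
  have split: "(norm (x - y))\<^sup>2 + 2 * \<epsilon> * h (x, y) = a x + b y" for x y
  proof -
    have cross: "\<epsilon> * (x \<bullet> (block12 \<Gamma> *v y)) - \<epsilon> * (x \<bullet> (block12 \<Lambda> *v y)) = x \<bullet> y"
    proof -
      have eq: "block12 \<Lambda> *v y = (- 1 / \<epsilon>) *\<^sub>R (y - \<epsilon> *\<^sub>R (block12 \<Gamma> *v y))"
        by (simp only: \<Lambda>12 M_def matrix_vector_simps matrix_vector_mul_lid)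
      show ?thesis unfolding eq using \<open>\<epsilon> > 0\<close> by (simp add: inner_diff_right field_simps)
    qed
    have "2 * \<epsilon> * h (x, y) = 2 * \<epsilon> * c + \<epsilon> * (x \<bullet> (Q1 *v x) - x \<bullet> (P1 *v x)) +
      \<epsilon> * (y \<bullet> (Q2 *v y) - y \<bullet> (P2 *v y)) +
      2 * (\<epsilon> * (x \<bullet> (block12 \<Gamma> *v y)) - \<epsilon> * (x \<bullet> (block12 \<Lambda> *v y)))"
      by (simp add: h_def P Q field_simps)
    then show ?thesis
      unfolding cross
      by (simp add: a_def b_def power2_norm_eq_inner inner_diff_left inner_diff_right inner_commute)
  qed
  have const: "integrable (gaussian A) (\<lambda>_. 2 * \<epsilon> * c)"
    using prob_space_gaussian[OF \<open>pos_def A\<close>]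
    by (simp add: finite_measure.integrable_const prob_space.finite_measure)
  show ?thesis
    unfolding S_def[symmetric]
  proof (rule eot_solutions_of_separated_potentials[where h = h and a = a and b = b])
    show "gaussian_pair S \<in> couplings (gaussian A) (gaussian B)"
      using gaussian_pair_marginals[of A C B] S
      by (simp add: couplings_def prob_space_gaussian_pair S_def)
    show "integrable (gaussian A) a"
      unfolding a_def[abs_def]
      by (intro const Bochner_Integration.integrable_add Bochner_Integration.integrable_diff
          integrable_mult_right integrable_gaussian_norm_square integrable_gaussian_quadratic_form
          \<open>pos_def A\<close>)
    show "integrable (gaussian B) b"
      unfolding b_def[abs_def]
      by (intro Bochner_Integration.integrable_add Bochner_Integration.integrable_diff
          integrable_mult_right integrable_gaussian_norm_square integrable_gaussian_quadratic_form
          \<open>pos_def B\<close>)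
  qed (use assms(4-7) density split in
      \<open>auto intro: prob_space_gaussian_pair integrable_gaussian_norm_square h_meas\<close>)
qed

end
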